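(* Let $F$ be any free inverse semigroup. By O'Carroll's construction there are a semilattice $E$, a free group $G$ and a left action $\theta\colon G\to\mathrm{Aut}(E)$ such that $F$ embeds in the semidirect product $S=E\ast_\theta G$. If $F$ is not monogenic, then $F$ is not a Howson inverse semigroup, and therefore this $S$ is not a Howson inverse semigroup either. However, $G$, being a free group, is a Howson group. Consequently (when $F$ is not monogenic) the action $\theta$ is not locally finite.
   Context: A semilattice is a meet-semilattice $(E,\wedge)$, and $\mathrm{Aut}(E)$ is its group of semilattice automorphisms. A left action of a group $G$ on $E$ is a group homomorphism $\theta\colon G\to\mathrm{Aut}(E)$, $g\mapsto\theta_g$; write $g\cdot e=\theta_g(e)$. The semidirect product $E\ast_\theta G$ is the set $E\times G$ with multiplication $(e,g)(f,h)=(e\wedge(g\cdot f),gh)$; it is an inverse semigroup with $(e,g)^{-1}=(g^{-1}\cdot e,g^{-1})$. The action is locally finite if, for every finitely generated subgroup $H\le G$ and every $e\in E$, the orbit $H\cdot e=\{h\cdot e : h\in H\}$ is finite. A group is a Howson group if the intersection of any two of its finitely generated subgroups is finitely generated. An inverse semigroup is a Howson inverse semigroup if the intersection of any two of its finitely generated inverse subsemigroups is finitely generated (as an inverse semigroup); an empty intersection counts as finitely generated. A free inverse semigroup is monogenic if it is free on a one-element set. O'Carroll's construction is the one in L. O'Carroll, "Embedding theorems for proper inverse semigroups", J. Algebra 42 (1976), 26-40, which embeds every $E$-unitary inverse semigroup into a semidirect product of a semilattice by a group; $E$, $G$, $\theta$ and $S$ in the claim are those it provides for $F$. *)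

theory Defs
  imports "HOL-Algebra.Generated_Groups" "HOL-Algebra.Bij"
begin

section \<open>Inverse semigroups\<close>

record 'a sgrp = "'a partial_object" +
  sprod :: "'a \<Rightarrow> 'a \<Rightarrow> 'a" (infixl "\<cdot>\<index>" 70)

definition sgrp_hom :: "('a, 'm) sgrp_scheme \<Rightarrow> ('b, 'n) sgrp_scheme \<Rightarrow> ('a \<Rightarrow> 'b) set" where
  "sgrp_hom S T = {\<phi>. \<phi> \<in> carrier S \<rightarrow> carrier T \<and>
     (\<forall>x\<in>carrier S. \<forall>y\<in>carrier S. \<phi> (x \<cdot>\<^bsub>S\<^esub> y) = \<phi> x \<cdot>\<^bsub>T\<^esub> \<phi> y)}"

definition sgrp_embedding :: "('a, 'm) sgrp_scheme \<Rightarrow> ('b, 'n) sgrp_scheme \<Rightarrow> ('a \<Rightarrow> 'b) \<Rightarrow> bool" where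
  "sgrp_embedding S T \<phi> \<longleftrightarrow> \<phi> \<in> sgrp_hom S T \<and> inj_on \<phi> (carrier S)"

definition sgrp_iso :: "('a, 'm) sgrp_scheme \<Rightarrow> ('b, 'n) sgrp_scheme \<Rightarrow> ('a \<Rightarrow> 'b) set" where
  "sgrp_iso S T = {\<phi>. \<phi> \<in> sgrp_hom S T \<and> bij_betw \<phi> (carrier S) (carrier T)}"

definition semigroup_on_carrier :: "('a, 'm) sgrp_scheme \<Rightarrow> bool" where
  "semigroup_on_carrier S \<longleftrightarrow> carrier S \<noteq> {} \<and>
     (\<forall>x\<in>carrier S. \<forall>y\<in>carrier S. x \<cdot>\<^bsub>S\<^esub> y \<in> carrier S) \<and>
     (\<forall>x\<in>carrier S. \<forall>y\<in>carrier S. \<forall>z\<in>carrier S.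
        (x \<cdot>\<^bsub>S\<^esub> y) \<cdot>\<^bsub>S\<^esub> z = x \<cdot>\<^bsub>S\<^esub> (y \<cdot>\<^bsub>S\<^esub> z))"

definition sgrp_inverses :: "('a, 'm) sgrp_scheme \<Rightarrow> 'a \<Rightarrow> 'a \<Rightarrow> bool" where
  "sgrp_inverses S x y \<longleftrightarrow> x \<cdot>\<^bsub>S\<^esub> y \<cdot>\<^bsub>S\<^esub> x = x \<and> y \<cdot>\<^bsub>S\<^esub> x \<cdot>\<^bsub>S\<^esub> y = y"

definition inverse_semigroup :: "('a, 'm) sgrp_scheme \<Rightarrow> bool" where
  "inverse_semigroup S \<longleftrightarrow> semigroup_on_carrier S \<and>
     (\<forall>x\<in>carrier S. \<exists>!y. y \<in> carrier S \<and> sgrp_inverses S x y)"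

definition sgrp_inv :: "('a, 'm) sgrp_scheme \<Rightarrow> 'a \<Rightarrow> 'a" where
  "sgrp_inv S x = (THE y. y \<in> carrier S \<and> sgrp_inverses S x y)"

definition idems :: "('a, 'm) sgrp_scheme \<Rightarrow> 'a set" where
  "idems S = {e \<in> carrier S. e \<cdot>\<^bsub>S\<^esub> e = e}"

text \<open>The empty set is admitted here, and it is generated by the empty set; hence empty
  intersections of inverse subsemigroups count as finitely generated.\<close>

definition inverse_subsemigroup :: "'a set \<Rightarrow> ('a, 'm) sgrp_scheme \<Rightarrow> bool" where
  "inverse_subsemigroup H S \<longleftrightarrow> H \<subseteq> carrier S \<and>
     (\<forall>x\<in>H. \<forall>y\<in>H. x \<cdot>\<^bsub>S\<^esub> y \<in> H) \<and> (\<forall>x\<in>H. sgrp_inv S x \<in> H)"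

inductive_set inv_generate :: "('a, 'm) sgrp_scheme \<Rightarrow> 'a set \<Rightarrow> 'a set"
  for S and A where
    incl: "a \<in> A \<Longrightarrow> a \<in> inv_generate S A"
  | inv: "x \<in> inv_generate S A \<Longrightarrow> sgrp_inv S x \<in> inv_generate S A"
  | prod: "x \<in> inv_generate S A \<Longrightarrow> y \<in> inv_generate S A \<Longrightarrow> x \<cdot>\<^bsub>S\<^esub> y \<in> inv_generate S A"

definition fin_gen_inverse_subsemigroup :: "'a set \<Rightarrow> ('a, 'm) sgrp_scheme \<Rightarrow> bool" where
  "fin_gen_inverse_subsemigroup H S \<longleftrightarrow> inverse_subsemigroup H S \<and>
     (\<exists>A. finite A \<and> A \<subseteq> carrier S \<and> H = inv_generate S A)"

text \<open>This predicate and \<open>locally_finite_action\<close> below do not include the axioms of the underlying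
  structure, so that their negations really say that the finiteness property fails.\<close>

definition howson_inverse_semigroup :: "('a, 'm) sgrp_scheme \<Rightarrow> bool" where
  "howson_inverse_semigroup S \<longleftrightarrow>
     (\<forall>H K. fin_gen_inverse_subsemigroup H S \<and> fin_gen_inverse_subsemigroup K S
        \<longrightarrow> fin_gen_inverse_subsemigroup (H \<inter> K) S)"


section \<open>Howson groups\<close>

definition fin_gen_subgroup :: "'a set \<Rightarrow> ('a, 'm) monoid_scheme \<Rightarrow> bool" where
  "fin_gen_subgroup H G \<longleftrightarrow> subgroup H G \<and>
     (\<exists>A. finite A \<and> A \<subseteq> carrier G \<and> H = generate G A)"

definition howson_group :: "('a, 'm) monoid_scheme \<Rightarrow> bool" where
  "howson_group G \<longleftrightarrow> group G \<and>
     (\<forall>H K. fin_gen_subgroup H G \<and> fin_gen_subgroup K G \<longrightarrow> fin_gen_subgroup (H \<inter> K) G)"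


section \<open>Semilattices, actions and semidirect products\<close>

definition meet_semilattice :: "('e, 'm) sgrp_scheme \<Rightarrow> bool" where
  "meet_semilattice E \<longleftrightarrow> semigroup_on_carrier E \<and>
     (\<forall>x\<in>carrier E. \<forall>y\<in>carrier E. x \<cdot>\<^bsub>E\<^esub> y = y \<cdot>\<^bsub>E\<^esub> x) \<and>
     (\<forall>x\<in>carrier E. x \<cdot>\<^bsub>E\<^esub> x = x)"

definition semilattice_Aut :: "('e, 'm) sgrp_scheme \<Rightarrow> ('e \<Rightarrow> 'e) monoid" where
  "semilattice_Aut E =
     BijGroup (carrier E) \<lparr>carrier := Bij (carrier E) \<inter> sgrp_hom E E\<rparr>"

definition semilattice_action ::
    "('g, 'n) monoid_scheme \<Rightarrow> ('e, 'm) sgrp_scheme \<Rightarrow> ('g \<Rightarrow> 'e \<Rightarrow> 'e) \<Rightarrow> bool" where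
  "semilattice_action G E \<theta> \<longleftrightarrow>
     group G \<and> meet_semilattice E \<and> \<theta> \<in> hom G (semilattice_Aut E)"

definition locally_finite_action ::
    "('g, 'n) monoid_scheme \<Rightarrow> ('e, 'm) sgrp_scheme \<Rightarrow> ('g \<Rightarrow> 'e \<Rightarrow> 'e) \<Rightarrow> bool" where
  "locally_finite_action G E \<theta> \<longleftrightarrow>
     (\<forall>H e. fin_gen_subgroup H G \<and> e \<in> carrier E \<longrightarrow> finite {\<theta> h e | h. h \<in> H})"

definition semidirect_product ::
    "('e, 'm) sgrp_scheme \<Rightarrow> ('g \<Rightarrow> 'e \<Rightarrow> 'e) \<Rightarrow> ('g, 'n) monoid_scheme \<Rightarrow> ('e \<times> 'g) sgrp" where
  "semidirect_product E \<theta> G =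
     \<lparr>carrier = carrier E \<times> carrier G,
      sprod = (\<lambda>(e, g) (f, h). (e \<cdot>\<^bsub>E\<^esub> \<theta> g f, g \<otimes>\<^bsub>G\<^esub> h))\<rparr>"


section \<open>Free inverse semigroups and free groups\<close>

text \<open>A word over \<open>X \<union> X\<^sup>-\<^sup>1\<close> is a list of pairs; \<open>(x, True)\<close> stands for the letter \<open>x\<close>
  and \<open>(x, False)\<close> for the letter \<open>x\<^sup>-\<^sup>1\<close>.\<close>

type_synonym 'x word = "('x \<times> bool) list"

definition words :: "'x set \<Rightarrow> 'x word set" where
  "words X = lists (X \<times> UNIV)"

definition word_inv :: "'x word \<Rightarrow> 'x word" where
  "word_inv w = rev (map (\<lambda>(x, b). (x, \<not> b)) w)"

text \<open>The Vagner congruence on the free semigroup of nonempty words, and the congruence on the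
  free monoid of all words whose quotient is the free group.\<close>

inductive_set vagner_cong :: "'x set \<Rightarrow> ('x word \<times> 'x word) set" for X where
    refl: "u \<in> words X \<Longrightarrow> u \<noteq> [] \<Longrightarrow> (u, u) \<in> vagner_cong X"
  | sym: "(u, v) \<in> vagner_cong X \<Longrightarrow> (v, u) \<in> vagner_cong X"
  | trans: "(u, v) \<in> vagner_cong X \<Longrightarrow> (v, w) \<in> vagner_cong X \<Longrightarrow> (u, w) \<in> vagner_cong X"
  | compat: "(u, u') \<in> vagner_cong X \<Longrightarrow> (v, v') \<in> vagner_cong X
      \<Longrightarrow> (u @ v, u' @ v') \<in> vagner_cong X"
  | regular: "u \<in> words X \<Longrightarrow> u \<noteq> [] \<Longrightarrow> (u @ word_inv u @ u, u) \<in> vagner_cong X"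
  | commute: "u \<in> words X \<Longrightarrow> u \<noteq> [] \<Longrightarrow> v \<in> words X \<Longrightarrow> v \<noteq> []
      \<Longrightarrow> (u @ word_inv u @ v @ word_inv v, v @ word_inv v @ u @ word_inv u) \<in> vagner_cong X"

definition FIS :: "'x set \<Rightarrow> 'x word set sgrp" where
  "FIS X =
     \<lparr>carrier = (words X - {[]}) // vagner_cong X,
      sprod = (\<lambda>A B. \<Union>a\<in>A. \<Union>b\<in>B. vagner_cong X `` {a @ b})\<rparr>"

inductive_set free_group_cong :: "'x set \<Rightarrow> ('x word \<times> 'x word) set" for X where
    refl: "u \<in> words X \<Longrightarrow> (u, u) \<in> free_group_cong X"
  | sym: "(u, v) \<in> free_group_cong X \<Longrightarrow> (v, u) \<in> free_group_cong X"
  | trans: "(u, v) \<in> free_group_cong X \<Longrightarrow> (v, w) \<in> free_group_cong X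
      \<Longrightarrow> (u, w) \<in> free_group_cong X"
  | compat: "(u, u') \<in> free_group_cong X \<Longrightarrow> (v, v') \<in> free_group_cong X
      \<Longrightarrow> (u @ v, u' @ v') \<in> free_group_cong X"
  | cancel: "x \<in> X \<Longrightarrow> ([(x, b), (x, \<not> b)], []) \<in> free_group_cong X"

definition FG :: "'x set \<Rightarrow> 'x word set monoid" where
  "FG X =
     \<lparr>carrier = words X // free_group_cong X,
      mult = (\<lambda>A B. \<Union>a\<in>A. \<Union>b\<in>B. free_group_cong X `` {a @ b}),
      one = free_group_cong X `` {[]}\<rparr>"

text \<open>Semigroups are nonempty, so an inverse semigroup is never free on the empty set.\<close>

definition free_inverse_semigroup_on :: "('a, 'm) sgrp_scheme \<Rightarrow> 'a set \<Rightarrow> bool" where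
  "free_inverse_semigroup_on F X \<longleftrightarrow> inverse_semigroup F \<and> X \<subseteq> carrier F \<and>
     (\<exists>\<phi>\<in>sgrp_iso (FIS X) F. \<forall>x\<in>X. \<phi> (vagner_cong X `` {[(x, True)]}) = x)"

definition free_inverse_semigroup :: "('a, 'm) sgrp_scheme \<Rightarrow> bool" where
  "free_inverse_semigroup F \<longleftrightarrow> (\<exists>X. free_inverse_semigroup_on F X)"

definition monogenic_free_inverse_semigroup :: "('a, 'm) sgrp_scheme \<Rightarrow> bool" where
  "monogenic_free_inverse_semigroup F \<longleftrightarrow> (\<exists>x. free_inverse_semigroup_on F {x})"

definition free_group_on :: "('a, 'm) monoid_scheme \<Rightarrow> 'a set \<Rightarrow> bool" where
  "free_group_on G X \<longleftrightarrow> group G \<and> X \<subseteq> carrier G \<and>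
     (\<exists>\<phi>\<in>iso (FG X) G. \<forall>x\<in>X. \<phi> (free_group_cong X `` {[(x, True)]}) = x)"

definition free_group :: "('a, 'm) monoid_scheme \<Rightarrow> bool" where
  "free_group G \<longleftrightarrow> (\<exists>X. free_group_on G X)"


section \<open>O'Carroll's construction\<close>

text \<open>For an \<open>E\<close>-unitary inverse semigroup \<open>T\<close>, take the McAlister triple \<open>(G, X, Y)\<close> with
  \<open>T\<close> isomorphic to \<open>P(G, X, Y)\<close> provided by the \<open>P\<close>-theorem, and embed \<open>P(G, X, Y)\<close> in the
  semidirect product of the semilattice of order ideals of \<open>X\<close> by \<open>G\<close> via
  \<open>(y, g) \<mapsto> (\<down>y, g)\<close>. Here \<open>G = T/\<sigma>\<close> is the maximum group image of \<open>T\<close>.\<close>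

definition nat_le :: "('a, 'm) sgrp_scheme \<Rightarrow> 'a \<Rightarrow> 'a \<Rightarrow> bool" where
  "nat_le T a b \<longleftrightarrow> (\<exists>e\<in>idems T. a = e \<cdot>\<^bsub>T\<^esub> b)"

definition min_group_cong :: "('a, 'm) sgrp_scheme \<Rightarrow> ('a \<times> 'a) set" where
  "min_group_cong T = {(a, b). a \<in> carrier T \<and> b \<in> carrier T \<and>
     (\<exists>c\<in>carrier T. nat_le T c a \<and> nat_le T c b)}"

text \<open>All idempotents of \<open>T\<close> are \<open>\<sigma>\<close>-related; their common class is the identity.\<close>

definition max_group_image :: "('a, 'm) sgrp_scheme \<Rightarrow> 'a set monoid" where
  "max_group_image T =
     \<lparr>carrier = carrier T // min_group_cong T,
      mult = (\<lambda>A B. \<Union>a\<in>A. \<Union>b\<in>B. min_group_cong T `` {a \<cdot>\<^bsub>T\<^esub> b}),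
      one = min_group_cong T `` idems T\<rparr>"

text \<open>The poset \<open>X\<close> is the quotient of the following preorder on \<open>G \<times> E(T)\<close>, in which
  \<open>(g, e)\<close> represents the point \<open>g \<cdot> e\<close> of \<open>X\<close>; the points \<open>1 \<cdot> e\<close> form \<open>Y\<close>.\<close>

definition mcalister_preorder :: "('a, 'm) sgrp_scheme \<Rightarrow> (('a set \<times> 'a) \<times> ('a set \<times> 'a)) set" where
  "mcalister_preorder T = {((g, e), (h, f)).
     g \<in> carrier (max_group_image T) \<and> h \<in> carrier (max_group_image T) \<and>
     e \<in> idems T \<and> f \<in> idems T \<and>
     (\<exists>s\<in>carrier T. g \<otimes>\<^bsub>max_group_image T\<^esub> (min_group_cong T `` {s}) = h \<and>
        s \<cdot>\<^bsub>T\<^esub> sgrp_inv T s = e \<and> nat_le T (sgrp_inv T s \<cdot>\<^bsub>T\<^esub> s) f)}"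

definition mcalister_equiv :: "('a, 'm) sgrp_scheme \<Rightarrow> (('a set \<times> 'a) \<times> ('a set \<times> 'a)) set" where
  "mcalister_equiv T = mcalister_preorder T \<inter> (mcalister_preorder T)\<inverse>"

definition mcalister_poset :: "('a, 'm) sgrp_scheme \<Rightarrow> ('a set \<times> 'a) set set" where
  "mcalister_poset T = (carrier (max_group_image T) \<times> idems T) // mcalister_equiv T"

definition mcalister_le ::
    "('a, 'm) sgrp_scheme \<Rightarrow> ('a set \<times> 'a) set \<Rightarrow> ('a set \<times> 'a) set \<Rightarrow> bool" where
  "mcalister_le T P Q \<longleftrightarrow> (\<exists>p\<in>P. \<exists>q\<in>Q. (p, q) \<in> mcalister_preorder T)"

definition mcalister_act ::
    "('a, 'm) sgrp_scheme \<Rightarrow> 'a set \<Rightarrow> ('a set \<times> 'a) set \<Rightarrow> ('a set \<times> 'a) set" where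
  "mcalister_act T g P = (\<lambda>(h, e). (g \<otimes>\<^bsub>max_group_image T\<^esub> h, e)) ` P"

definition ocarroll_semilattice :: "('a, 'm) sgrp_scheme \<Rightarrow> ('a set \<times> 'a) set set sgrp" where
  "ocarroll_semilattice T =
     \<lparr>carrier = {I. I \<subseteq> mcalister_poset T \<and>
        (\<forall>Q\<in>I. \<forall>P\<in>mcalister_poset T. mcalister_le T P Q \<longrightarrow> P \<in> I)},
      sprod = (\<inter>)\<rparr>"

abbreviation ocarroll_group :: "('a, 'm) sgrp_scheme \<Rightarrow> 'a set monoid" where
  "ocarroll_group T \<equiv> max_group_image T"

definition ocarroll_action ::
    "('a, 'm) sgrp_scheme \<Rightarrow> 'a set \<Rightarrow> ('a set \<times> 'a) set set \<Rightarrow> ('a set \<times> 'a) set set" where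
  "ocarroll_action T g = (\<lambda>I\<in>carrier (ocarroll_semilattice T). mcalister_act T g ` I)"

definition ocarroll_product :: "('a, 'm) sgrp_scheme \<Rightarrow> (('a set \<times> 'a) set set \<times> 'a set) sgrp" where
  "ocarroll_product T =
     semidirect_product (ocarroll_semilattice T) (ocarroll_action T) (ocarroll_group T)"

definition ocarroll_map :: "('a, 'm) sgrp_scheme \<Rightarrow> 'a \<Rightarrow> ('a set \<times> 'a) set set \<times> 'a set" where
  "ocarroll_map T s =
     ({P \<in> mcalister_poset T. mcalister_le T P
         (mcalister_equiv T `` {(\<one>\<^bsub>max_group_image T\<^esub>, s \<cdot>\<^bsub>T\<^esub> sgrp_inv T s)})},
      min_group_cong T `` {s})"

end

theory Submission
  imports Defs "HOL-Library.Sublist"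
begin

text \<open>O'Carroll's map embeds any \<open>E\<close>-unitary inverse semigroup, and a free inverse semigroup is
  \<open>E\<close>-unitary because a word that reduces to the empty word is a product of conjugates of
  shorter such words, hence represents an idempotent. Free groups are Howson groups since a subgroup
  is finitely generated iff the core of its Schreier graph is finite, and the core of \<open>H \<inter> K\<close> embeds
  in the product of the cores of \<open>H\<close> and \<open>K\<close>. That a free inverse semigroup with two free generators
  is not a Howson semigroup is read off from its action by partial injections on a ladder-shaped
  automaton. For the action, local finiteness is refuted directly: it would give
  \<open>x\<^sup>k x\<^sup>-\<^sup>k = x\<^sup>k\<^sup>+\<^sup>1 x\<^sup>-\<^sup>k\<^sup>-\<^sup>1\<close> for some \<open>k\<close> and any free generator \<open>x\<close>.\<close>

section \<open>Inverse semigroups\<close>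

text \<open>No normal form for the free inverse semigroup is developed. Elements are told apart by
  two invariants of the Vagner congruence only: the reduced word, and the partial injection that a
  word induces on the states of an automaton. The first is empty exactly on idempotents; this one
  fact yields both E-unitarity and the freeness of the maximum group image, but it cannot separate
  idempotents from one another. The second invariant does that. For this purpose the ladder carries
  a parameter \<open>D\<close>, the set of rail edges present: truncating the rail turns the
  question how far an element reaches into the question whether it is still defined at the origin,
  which is easy to follow through products and inverses. A finite generating set of the intersection
  then gives one truncation that harms no generated element defined at the origin of the full
  ladder.\<close>

locale inv_sgrp =
  fixes S :: "('a, 'm) sgrp_scheme" (structure)
  assumes inverse_semigroup: "inverse_semigroup S"
begin

abbreviation iv :: "'a \<Rightarrow> 'a" where "iv \<equiv> sgrp_inv S"

lemma closed [simp, intro]: "x \<in> carrier S \<Longrightarrow> y \<in> carrier S \<Longrightarrow> x \<cdot> y \<in> carrier S"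
  using inverse_semigroup by (simp add: inverse_semigroup_def semigroup_on_carrier_def)

lemma assoc:
  "x \<in> carrier S \<Longrightarrow> y \<in> carrier S \<Longrightarrow> z \<in> carrier S \<Longrightarrow> (x \<cdot> y) \<cdot> z = x \<cdot> (y \<cdot> z)"
  using inverse_semigroup by (simp add: inverse_semigroup_def semigroup_on_carrier_def)

lemma carrier_nonempty: "carrier S \<noteq> {}"
  using inverse_semigroup by (simp add: inverse_semigroup_def semigroup_on_carrier_def)

lemma ex1_inverse: "x \<in> carrier S \<Longrightarrow> \<exists>!y. y \<in> carrier S \<and> sgrp_inverses S x y"
  using inverse_semigroup by (simp add: inverse_semigroup_def)

lemma iv_spec: "x \<in> carrier S \<Longrightarrow> iv x \<in> carrier S \<and> sgrp_inverses S x (iv x)"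
  unfolding sgrp_inv_def by (rule theI') (rule ex1_inverse)

lemma iv_closed [simp, intro]: "x \<in> carrier S \<Longrightarrow> iv x \<in> carrier S"
  using iv_spec by blast

lemma iv_unique:
  "x \<in> carrier S \<Longrightarrow> y \<in> carrier S \<Longrightarrow> x \<cdot> y \<cdot> x = x \<Longrightarrow> y \<cdot> x \<cdot> y = y \<Longrightarrow> iv x = y"
  using ex1_inverse iv_spec unfolding sgrp_inverses_def by blast

lemma mult_iv_mult: "x \<in> carrier S \<Longrightarrow> x \<cdot> (iv x \<cdot> x) = x"
  using iv_spec[of x] by (simp add: sgrp_inverses_def assoc)

lemma iv_mult_iv: "x \<in> carrier S \<Longrightarrow> iv x \<cdot> (x \<cdot> iv x) = iv x"
  using iv_spec[of x] by (simp add: sgrp_inverses_def assoc)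

lemma mult_iv_mult2: "x \<in> carrier S \<Longrightarrow> z \<in> carrier S \<Longrightarrow> x \<cdot> (iv x \<cdot> (x \<cdot> z)) = x \<cdot> z"
  by (metis mult_iv_mult assoc closed iv_closed)

lemma iv_mult_iv2: "x \<in> carrier S \<Longrightarrow> z \<in> carrier S \<Longrightarrow> iv x \<cdot> (x \<cdot> (iv x \<cdot> z)) = iv x \<cdot> z"
  by (metis iv_mult_iv assoc closed iv_closed)

lemmas iv_simps = mult_iv_mult iv_mult_iv mult_iv_mult2 iv_mult_iv2

lemma iv_iv [simp]: "x \<in> carrier S \<Longrightarrow> iv (iv x) = x"
  by (rule iv_unique) (simp_all add: iv_simps assoc)


lemma idemsI: "e \<in> carrier S \<Longrightarrow> e \<cdot> e = e \<Longrightarrow> e \<in> idems S"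
  by (simp add: idems_def)

lemma idemsD: "e \<in> idems S \<Longrightarrow> e \<cdot> e = e"
  by (simp add: idems_def)

lemma idems_closed [simp]: "e \<in> idems S \<Longrightarrow> e \<in> carrier S"
  by (simp add: idems_def)

lemma idemsD2: "e \<in> idems S \<Longrightarrow> z \<in> carrier S \<Longrightarrow> e \<cdot> (e \<cdot> z) = e \<cdot> z"
  by (metis assoc idemsD idems_closed)

lemma iv_idem [simp]: "e \<in> idems S \<Longrightarrow> iv e = e"
  by (rule iv_unique) (simp_all add: idemsD)

lemma mult_iv_idem [simp]: "x \<in> carrier S \<Longrightarrow> x \<cdot> iv x \<in> idems S"
  by (rule idemsI) (simp_all add: assoc iv_simps)

lemma iv_mult_idem [simp]: "x \<in> carrier S \<Longrightarrow> iv x \<cdot> x \<in> idems S"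
  by (rule idemsI) (simp_all add: assoc iv_simps)

lemma idems_nonempty: "idems S \<noteq> {}"
  using carrier_nonempty mult_iv_idem by blast

text \<open>By uniqueness the inverse \<open>x\<close> of \<open>e \<cdot> f\<close> equals
  \<open>f \<cdot> x \<cdot> e\<close>, and an element of this form squares to itself. An idempotent
  is its own inverse, so \<open>x = e \<cdot> f\<close>.\<close>

lemma idem_mult:
  assumes e: "e \<in> idems S" and f: "f \<in> idems S"
  shows "e \<cdot> f \<in> idems S"
proof -
  note c = idems_closed[OF e] idems_closed[OF f]
  define x where "x = iv (e \<cdot> f)"
  have x: "x \<in> carrier S" and 1: "(e \<cdot> f) \<cdot> (x \<cdot> (e \<cdot> f)) = e \<cdot> f"
    and 2: "x \<cdot> ((e \<cdot> f) \<cdot> x) = x"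
    using c by (auto simp: x_def mult_iv_mult iv_mult_iv)
  have two: "x \<cdot> (e \<cdot> (f \<cdot> (x \<cdot> z))) = x \<cdot> z" if "z \<in> carrier S" for z
    using arg_cong[OF 2, of "\<lambda>t. t \<cdot> z"] that c x by (simp add: assoc)
  have fxe: "x = f \<cdot> x \<cdot> e"
    unfolding x_def
  proof (rule iv_unique, fold x_def)
    show "e \<cdot> f \<cdot> (f \<cdot> x \<cdot> e) \<cdot> (e \<cdot> f) = e \<cdot> f"
      using 1 c x by (simp add: assoc idemsD2[OF e] idemsD2[OF f])
    show "f \<cdot> x \<cdot> e \<cdot> (e \<cdot> f) \<cdot> (f \<cdot> x \<cdot> e) = f \<cdot> x \<cdot> e"
      using c x by (simp add: assoc idemsD2[OF e] idemsD2[OF f] two)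
  qed (use c x in auto)
  have "x \<cdot> x = f \<cdot> x \<cdot> e \<cdot> (f \<cdot> x \<cdot> e)"
    by (rule arg_cong2[OF fxe fxe, of "(\<cdot>)"])
  also have "\<dots> = f \<cdot> x \<cdot> e"
    using c x by (simp add: assoc two)
  finally have xi: "x \<in> idems S"
    using fxe x idemsI by metis
  have "iv x = e \<cdot> f"
    using c by (simp add: x_def)
  then have "x = e \<cdot> f"
    unfolding iv_idem[OF xi] .
  then show ?thesis
    using xi by (rule subst)
qed

text \<open>\<open>f \<cdot> e\<close> satisfies the equations of an inverse of
  \<open>e \<cdot> f\<close>, which as an idempotent is its own inverse.\<close>

lemma idem_commute:
  assumes e: "e \<in> idems S" and f: "f \<in> idems S"
  shows "e \<cdot> f = f \<cdot> e"
proof -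
  note c = idems_closed[OF e] idems_closed[OF f]
  note ef = idemsD[OF idem_mult[OF e f]] and fe = idemsD[OF idem_mult[OF f e]]
  have "iv (e \<cdot> f) = f \<cdot> e"
  proof (rule iv_unique)
    show "e \<cdot> f \<cdot> (f \<cdot> e) \<cdot> (e \<cdot> f) = e \<cdot> f"
      using c ef by (simp add: assoc idemsD2[OF e] idemsD2[OF f])
    show "f \<cdot> e \<cdot> (e \<cdot> f) \<cdot> (f \<cdot> e) = f \<cdot> e"
      using c fe by (simp add: assoc idemsD2[OF e] idemsD2[OF f])
  qed (use c in auto)
  then show ?thesis
    using idem_mult[OF e f] by simp
qed

lemma idem_left_commute:
  "e \<in> idems S \<Longrightarrow> f \<in> idems S \<Longrightarrow> z \<in> carrier S \<Longrightarrow> e \<cdot> (f \<cdot> z) = f \<cdot> (e \<cdot> z)"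
  by (metis assoc idem_commute idems_closed)

lemma iv_mult:
  assumes x: "x \<in> carrier S" and y: "y \<in> carrier S"
  shows "iv (x \<cdot> y) = iv y \<cdot> iv x"
proof -
  \<comment> \<open>The whole proof is the commutation of \<open>y \<cdot> iv y\<close> with
    \<open>iv x \<cdot> x\<close>. It is stated with a tail \<open>z\<close> and in both directions,
    so that each of the two inverse equations gets a suitable rewrite rule.\<close>
  have 1: "y \<cdot> (iv y \<cdot> (iv x \<cdot> (x \<cdot> z))) = iv x \<cdot> (x \<cdot> (y \<cdot> (iv y \<cdot> z)))" if "z \<in> carrier S" for z
    using idem_left_commute[of "y \<cdot> iv y" "iv x \<cdot> x" z] that x y by (simp add: assoc)
  have 2: "iv x \<cdot> (x \<cdot> (y \<cdot> (iv y \<cdot> z))) = y \<cdot> (iv y \<cdot> (iv x \<cdot> (x \<cdot> z)))" if "z \<in> carrier S" for z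
    using 1 that by simp
  show ?thesis
  proof (rule iv_unique)
    show "x \<cdot> y \<cdot> (iv y \<cdot> iv x) \<cdot> (x \<cdot> y) = x \<cdot> y"
      using x y by (simp add: assoc 1 iv_simps)
    show "iv y \<cdot> iv x \<cdot> (x \<cdot> y) \<cdot> (iv y \<cdot> iv x) = iv y \<cdot> iv x"
      using x y by (simp add: assoc 2 iv_simps)
  qed (use x y in auto)
qed

lemma conj_idem:
  assumes "e \<in> idems S" "x \<in> carrier S"
  shows "x \<cdot> (e \<cdot> iv x) \<in> idems S"
proof -
  have "e \<cdot> (iv x \<cdot> (x \<cdot> (e \<cdot> iv x))) = iv x \<cdot> (x \<cdot> (e \<cdot> iv x))"
    using idem_left_commute[of e "iv x \<cdot> x" "e \<cdot> iv x"] assms by (simp add: assoc idemsD2)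
  then show ?thesis
    using assms by (intro idemsI) (simp_all add: assoc iv_simps)
qed

text \<open>An idempotent passes from the right of \<open>x\<close> to the left as its conjugate.
  This makes the left-handed order \<open>nat_le\<close> compatible with products.\<close>

lemma mult_idem_right:
  assumes "e \<in> idems S" "x \<in> carrier S"
  shows "x \<cdot> e = x \<cdot> (e \<cdot> iv x) \<cdot> x"
  using idem_commute[of e "iv x \<cdot> x"] assms by (simp add: assoc iv_simps)

subsection \<open>The natural partial order\<close>

lemma nat_leI: "e \<in> idems S \<Longrightarrow> a = e \<cdot> b \<Longrightarrow> nat_le S a b"
  by (auto simp: nat_le_def)

lemma nat_le_closed: "nat_le S a b \<Longrightarrow> b \<in> carrier S \<Longrightarrow> a \<in> carrier S"
  by (auto simp: nat_le_def)

lemma nat_le_refl: "a \<in> carrier S \<Longrightarrow> nat_le S a a"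
  by (rule nat_leI[of "a \<cdot> iv a"]) (simp_all add: assoc iv_simps)

lemma nat_le_trans: "nat_le S a b \<Longrightarrow> nat_le S b c \<Longrightarrow> c \<in> carrier S \<Longrightarrow> nat_le S a c"
  by (auto simp: nat_le_def) (metis assoc idem_mult idems_closed)

lemma nat_le_mult:
  assumes "nat_le S a a'" "nat_le S b b'" "a' \<in> carrier S" "b' \<in> carrier S"
  shows "nat_le S (a \<cdot> b) (a' \<cdot> b')"
proof -
  from assms obtain e f where e: "e \<in> idems S" "a = e \<cdot> a'" and f: "f \<in> idems S" "b = f \<cdot> b'"
    by (auto simp: nat_le_def)
  have "a \<cdot> b = e \<cdot> ((a' \<cdot> f) \<cdot> b')"
    using e f assms(3,4) by (simp add: assoc)
  also have "\<dots> = (e \<cdot> (a' \<cdot> (f \<cdot> iv a'))) \<cdot> (a' \<cdot> b')"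
    using mult_idem_right[of f a'] e f assms(3,4) by (simp add: assoc)
  finally show ?thesis
    using e f conj_idem[of f a'] idem_mult assms(3) by (intro nat_leI) auto
qed

lemma nat_le_idem_iff:
  assumes "e \<in> idems S" "f \<in> idems S"
  shows "nat_le S e f \<longleftrightarrow> e \<cdot> f = e"
  using assms by (metis nat_le_def assoc idems_closed idemsD)

lemma nat_le_antisym_idem:
  "e \<in> idems S \<Longrightarrow> f \<in> idems S \<Longrightarrow> nat_le S e f \<Longrightarrow> nat_le S f e \<Longrightarrow> e = f"
  by (metis nat_le_idem_iff idem_commute)

lemma nat_le_mult_idem_idem: "e \<in> idems S \<Longrightarrow> f \<in> idems S \<Longrightarrow> nat_le S (e \<cdot> f) f"
  by (auto intro: nat_leI)

subsection \<open>The maximum group image\<close>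

lemma min_group_congI:
  "a \<in> carrier S \<Longrightarrow> b \<in> carrier S \<Longrightarrow> nat_le S c a \<Longrightarrow> nat_le S c b \<Longrightarrow> (a, b) \<in> min_group_cong S"
  using nat_le_closed by (auto simp: min_group_cong_def)

lemma min_group_congE:
  assumes "(a, b) \<in> min_group_cong S"
  obtains c where "a \<in> carrier S" "b \<in> carrier S" "c \<in> carrier S" "nat_le S c a" "nat_le S c b"
  using assms by (auto simp: min_group_cong_def)

lemma min_group_cong_mult:
  assumes "(a, a') \<in> min_group_cong S" "(b, b') \<in> min_group_cong S"
  shows "(a \<cdot> b, a' \<cdot> b') \<in> min_group_cong S"
  using assms by (elim min_group_congE) (blast intro: min_group_congI nat_le_mult)

lemma equiv_min_group_cong: "equiv (carrier S) (min_group_cong S)"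
proof (rule equivI)
  show "min_group_cong S \<subseteq> carrier S \<times> carrier S"
    by (auto simp: min_group_cong_def)
  show "refl_on (carrier S) (min_group_cong S)"
    by (auto simp: refl_on_def intro: min_group_congI nat_le_refl)
  show "sym (min_group_cong S)"
    by (auto simp: sym_def elim!: min_group_congE intro: min_group_congI)
  show "trans (min_group_cong S)"
  proof (rule transI)
    fix a b d assume "(a, b) \<in> min_group_cong S" "(b, d) \<in> min_group_cong S"
    then obtain e f e' f' where *: "a \<in> carrier S" "b \<in> carrier S" "d \<in> carrier S"
      "e \<in> idems S" "f \<in> idems S" "e' \<in> idems S" "f' \<in> idems S"
      "e \<cdot> a = f \<cdot> b" "e' \<cdot> b = f' \<cdot> d"
      by (auto simp: min_group_cong_def nat_le_def)
    \<comment> \<open>Two lower bounds of \<open>b\<close> are merged by applying both idempotents;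
      the result lies below \<open>a\<close> and below \<open>d\<close>.\<close>
    have "(e' \<cdot> e) \<cdot> a = e' \<cdot> (f \<cdot> b)"
      using * by (simp add: assoc)
    also have "\<dots> = (f \<cdot> f') \<cdot> d"
      using * idem_left_commute[of e' f b] by (simp add: assoc)
    finally have eq: "(e' \<cdot> e) \<cdot> a = (f \<cdot> f') \<cdot> d" .
    show "(a, d) \<in> min_group_cong S"
    proof (rule min_group_congI)
      show "nat_le S ((e' \<cdot> e) \<cdot> a) a"
        using * by (intro nat_leI[of "e' \<cdot> e"]) (auto intro: idem_mult)
      show "nat_le S ((e' \<cdot> e) \<cdot> a) d"
        using * eq by (intro nat_leI[of "f \<cdot> f'"]) (auto intro: idem_mult)
    qed (use * in auto)
  qed
qed

abbreviation sig :: "'a \<Rightarrow> 'a set" where "sig a \<equiv> min_group_cong S `` {a}"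

abbreviation GI :: "'a set monoid" where "GI \<equiv> max_group_image S"

lemma sig_eq_iff: "a \<in> carrier S \<Longrightarrow> b \<in> carrier S \<Longrightarrow> sig a = sig b \<longleftrightarrow> (a, b) \<in> min_group_cong S"
  using eq_equiv_class_iff[OF equiv_min_group_cong] by blast

lemma sig_closed [simp, intro]: "a \<in> carrier S \<Longrightarrow> sig a \<in> carrier GI"
  by (simp add: max_group_image_def quotientI)

lemma GI_elemE:
  assumes "g \<in> carrier GI"
  obtains a where "a \<in> carrier S" "g = sig a"
  using assms by (auto simp: max_group_image_def quotient_def)

lemma sig_mult:
  assumes "a \<in> carrier S" "b \<in> carrier S"
  shows "sig a \<otimes>\<^bsub>GI\<^esub> sig b = sig (a \<cdot> b)"
proof -
  have "sig (a' \<cdot> b') = sig (a \<cdot> b)" if "a' \<in> sig a" "b' \<in> sig b" for a' b'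
    using that min_group_cong_mult equiv_class_eq[OF equiv_min_group_cong] by blast
  moreover have "a \<in> sig a" "b \<in> sig b"
    using equiv_class_self[OF equiv_min_group_cong] assms by auto
  ultimately have "(\<Union>a'\<in>sig a. \<Union>b'\<in>sig b. sig (a' \<cdot> b')) = sig (a \<cdot> b)"
    by blast
  then show ?thesis
    by (simp add: max_group_image_def)
qed

lemma sig_idem:
  assumes e: "e \<in> idems S"
  shows "sig e = \<one>\<^bsub>GI\<^esub>"
proof -
  have "sig f = sig e" if "f \<in> idems S" for f
  proof -
    have "nat_le S (f \<cdot> e) e" "nat_le S (f \<cdot> e) f"
      using e that by (auto intro: nat_leI simp: idem_commute[OF that e])
    then show ?thesis
      using e that by (simp add: sig_eq_iff min_group_congI)
  qed
  then have "min_group_cong S `` idems S = sig e"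
    using e by blast
  then show ?thesis by (simp add: max_group_image_def)
qed

lemma one_GI_closed: "\<one>\<^bsub>GI\<^esub> \<in> carrier GI"
  using sig_idem idems_nonempty sig_closed idems_closed by (metis equals0I)

lemma group_GI: "group GI"
proof (rule groupI)
  show one: "\<one>\<^bsub>GI\<^esub> \<in> carrier GI" by (rule one_GI_closed)
  fix x assume x: "x \<in> carrier GI"
  then obtain a where a: "a \<in> carrier S" "x = sig a" by (rule GI_elemE)
  have "\<one>\<^bsub>GI\<^esub> \<otimes>\<^bsub>GI\<^esub> x = sig ((a \<cdot> iv a) \<cdot> a)"
    using a sig_idem[of "a \<cdot> iv a"] sig_mult[of "a \<cdot> iv a" a] by simp
  then show "\<one>\<^bsub>GI\<^esub> \<otimes>\<^bsub>GI\<^esub> x = x" using a by (simp add: assoc iv_simps)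
  have "sig (iv a) \<otimes>\<^bsub>GI\<^esub> x = \<one>\<^bsub>GI\<^esub>"
    using a sig_mult[of "iv a" a] sig_idem[of "iv a \<cdot> a"] by simp
  then show "\<exists>y\<in>carrier GI. y \<otimes>\<^bsub>GI\<^esub> x = \<one>\<^bsub>GI\<^esub>" using a by blast
  fix y assume "y \<in> carrier GI"
  then obtain b where b: "b \<in> carrier S" "y = sig b" by (rule GI_elemE)
  show "x \<otimes>\<^bsub>GI\<^esub> y \<in> carrier GI" using a b by (simp add: sig_mult)
  fix z assume "z \<in> carrier GI"
  then obtain c where c: "c \<in> carrier S" "z = sig c" by (rule GI_elemE)
  show "x \<otimes>\<^bsub>GI\<^esub> y \<otimes>\<^bsub>GI\<^esub> z = x \<otimes>\<^bsub>GI\<^esub> (y \<otimes>\<^bsub>GI\<^esub> z)"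
    using a b c by (simp add: sig_mult assoc)
qed

sublocale G: group "max_group_image S"
  by (rule group_GI)

lemma sig_iv: "a \<in> carrier S \<Longrightarrow> sig (iv a) = inv\<^bsub>GI\<^esub> (sig a)"
  by (rule G.inv_equality[symmetric]) (simp_all add: sig_mult sig_idem)

end

definition e_unitary :: "('a, 'm) sgrp_scheme \<Rightarrow> bool" where
  "e_unitary S \<longleftrightarrow> (\<forall>e\<in>idems S. \<forall>a\<in>carrier S. nat_le S e a \<longrightarrow> a \<in> idems S)"

context inv_sgrp
begin

text \<open>\<open>a\<close> and \<open>a \<cdot> iv a\<close> are congruent, as both map to the
  identity. A common lower bound of them is idempotent, being below an idempotent, and E-unitarity
  carries this up to \<open>a\<close>.\<close>

lemma e_unitary_sig_one:
  assumes "e_unitary S" "a \<in> carrier S" "sig a = \<one>\<^bsub>GI\<^esub>"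
  shows "a \<in> idems S"
proof -
  define e where "e = a \<cdot> iv a"
  have e: "e \<in> idems S"
    using assms by (simp add: e_def)
  have "(a, e) \<in> min_group_cong S"
    using assms(2,3) e sig_idem[OF e] sig_eq_iff[of a e] by simp
  then obtain c where c: "nat_le S c a" "nat_le S c e"
    by (auto elim: min_group_congE)
  then obtain f where "f \<in> idems S" "c = f \<cdot> e"
    by (auto simp: nat_le_def)
  then have "c \<in> idems S"
    using e by (simp add: idem_mult)
  then show ?thesis
    using assms(1,2) c(1) unfolding e_unitary_def by blast
qed

text \<open>\<open>f = iv s \<cdot> t\<close> maps to the identity, so it is idempotent, and
  \<open>s \<cdot> f = t\<close>. Substituting this for \<open>t\<close> in
  \<open>s = t \<cdot> iv t \<cdot> s\<close> and commuting idempotents gives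
  \<open>s = s \<cdot> f\<close>. This is the source of the injectivity of
  \<open>ocarroll_map\<close>.\<close>

lemma e_unitary_eqI:
  assumes E: "e_unitary S" and s: "s \<in> carrier S" and t: "t \<in> carrier S"
    and sig: "sig s = sig t" and eq: "s \<cdot> iv s = t \<cdot> iv t"
  shows "s = t"
proof -
  define f where "f = iv s \<cdot> t"
  have fc: "f \<in> carrier S"
    using s t by (simp add: f_def)
  have "sig f = \<one>\<^bsub>GI\<^esub>"
    using s t sig_mult[of "iv s" t] sig sig_iv[of s] by (simp add: f_def)
  then have f: "f \<in> idems S"
    using e_unitary_sig_one[OF E fc] by simp
  have sf: "s \<cdot> f = t"
    using s t eq by (metis f_def assoc iv_closed mult_iv_mult)
  have "s = s \<cdot> iv s \<cdot> s"
    using s by (simp add: assoc mult_iv_mult)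
  also have "\<dots> = t \<cdot> iv t \<cdot> s"
    by (simp only: eq)
  also have "\<dots> = s \<cdot> (f \<cdot> (f \<cdot> (iv s \<cdot> s)))"
    using s f fc by (simp add: sf[symmetric] iv_mult assoc)
  also have "\<dots> = s \<cdot> f"
    using s f idem_commute[of f "iv s \<cdot> s"] idem_left_commute[of f "iv s \<cdot> s" f]
    by (simp add: idemsD idemsD2 assoc iv_simps)
  finally show ?thesis
    using sf by simp
qed

section \<open>O'Carroll's embedding\<close>

abbreviation pre where "pre \<equiv> mcalister_preorder S"
abbreviation cls where "cls g e \<equiv> mcalister_equiv S `` {(g, e)}"

lemma pre_iff:
  "g \<in> carrier GI \<Longrightarrow> h \<in> carrier GI \<Longrightarrow> e \<in> idems S \<Longrightarrow> f \<in> idems S \<Longrightarrow>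
   ((g, e), (h, f)) \<in> pre \<longleftrightarrow>
   (\<exists>s\<in>carrier S. g \<otimes>\<^bsub>GI\<^esub> sig s = h \<and> s \<cdot> iv s = e \<and> nat_le S (iv s \<cdot> s) f)"
  by (simp add: mcalister_preorder_def)

lemma pre_closed: "(p, q) \<in> pre \<Longrightarrow> p \<in> carrier GI \<times> idems S \<and> q \<in> carrier GI \<times> idems S"
  by (auto simp: mcalister_preorder_def)

lemma pre_refl:
  assumes "p \<in> carrier GI \<times> idems S"
  shows "(p, p) \<in> pre"
proof -
  obtain g e where p: "p = (g, e)" "g \<in> carrier GI" "e \<in> idems S"
    using assms by auto
  then have "g \<otimes>\<^bsub>GI\<^esub> sig e = g"
    unfolding sig_idem[OF p(3)] by simp
  moreover have "e \<cdot> iv e = e" "nat_le S (iv e \<cdot> e) e"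
    using p by (simp_all add: idemsD nat_le_refl)
  ultimately show ?thesis
    unfolding p(1) pre_iff[OF p(2,2,3,3)] using p(3) idems_closed by blast
qed

lemma pre_idem_le:
  assumes "e \<in> idems S" "f \<in> idems S" "nat_le S e f"
  shows "((\<one>\<^bsub>GI\<^esub>, e), (\<one>\<^bsub>GI\<^esub>, f)) \<in> pre"
proof -
  have "\<one>\<^bsub>GI\<^esub> \<otimes>\<^bsub>GI\<^esub> sig e = \<one>\<^bsub>GI\<^esub>"
    unfolding sig_idem[OF assms(1)] by simp
  moreover have "e \<cdot> iv e = e" "nat_le S (iv e \<cdot> e) f"
    using assms by (simp_all add: idemsD)
  ultimately show ?thesis
    unfolding pre_iff[OF G.one_closed G.one_closed assms(1,2)]
    using assms(1) idems_closed by blast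
qed

text \<open>Witnesses multiply: \<open>s \<cdot> f = s\<close> ensures that
  \<open>s \<cdot> t\<close> still has the range idempotent \<open>e\<close> of
  \<open>s\<close>.\<close>

lemma pre_trans:
  assumes "(p, q) \<in> pre" "(q, r) \<in> pre"
  shows "(p, r) \<in> pre"
proof -
  obtain g e h f k d where pqr: "p = (g, e)" "q = (h, f)" "r = (k, d)"
    by (metis surj_pair)
  have c: "g \<in> carrier GI" "h \<in> carrier GI" "k \<in> carrier GI"
    "e \<in> idems S" "f \<in> idems S" "d \<in> idems S"
    using assms pre_closed pqr by auto
  obtain s where s: "s \<in> carrier S" "g \<otimes>\<^bsub>GI\<^esub> sig s = h" "s \<cdot> iv s = e" "nat_le S (iv s \<cdot> s) f"
    using assms(1) c by (auto simp: pqr pre_iff)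
  obtain t where t: "t \<in> carrier S" "h \<otimes>\<^bsub>GI\<^esub> sig t = k" "t \<cdot> iv t = f" "nat_le S (iv t \<cdot> t) d"
    using assms(2) c by (auto simp: pqr pre_iff)
  have "iv s \<cdot> s \<cdot> f = iv s \<cdot> s"
    using nat_le_idem_iff[of "iv s \<cdot> s" f] s c by simp
  then have sf: "s \<cdot> f = s"
    using s c by (metis assoc mult_iv_mult idems_closed iv_closed closed)
  have "s \<cdot> t \<cdot> iv (s \<cdot> t) = (s \<cdot> f) \<cdot> iv s"
    using s t(1) by (simp add: t(3)[symmetric] iv_mult assoc)
  then have "s \<cdot> t \<cdot> iv (s \<cdot> t) = e"
    using s by (simp add: sf)
  moreover have "nat_le S (iv (s \<cdot> t) \<cdot> (s \<cdot> t)) d"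
  proof -
    have "iv (s \<cdot> t) \<cdot> (s \<cdot> t) \<cdot> (iv t \<cdot> t) = iv (s \<cdot> t) \<cdot> (s \<cdot> t)"
      using s t(1) by (simp add: assoc iv_simps)
    then have "nat_le S (iv (s \<cdot> t) \<cdot> (s \<cdot> t)) (iv t \<cdot> t)"
      using s(1) t(1) by (simp add: nat_le_idem_iff)
    then show ?thesis
      using t(4) c(6) nat_le_trans by auto
  qed
  moreover have "g \<otimes>\<^bsub>GI\<^esub> sig (s \<cdot> t) = k"
    using s(1,2) t(1,2) c by (simp add: sig_mult[symmetric] G.m_assoc[symmetric])
  ultimately show ?thesis
    using s(1) t(1) c by (auto simp: pqr pre_iff)
qed

lemma equiv_mcalister: "equiv (carrier GI \<times> idems S) (mcalister_equiv S)"
proof (rule equivI)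
  show "mcalister_equiv S \<subseteq> (carrier GI \<times> idems S) \<times> (carrier GI \<times> idems S)"
    using pre_closed by (fastforce simp: mcalister_equiv_def)
  show "refl_on (carrier GI \<times> idems S) (mcalister_equiv S)"
    using pre_refl by (auto simp: refl_on_def mcalister_equiv_def)
  show "sym (mcalister_equiv S)"
    by (auto simp: sym_def mcalister_equiv_def)
  show "trans (mcalister_equiv S)"
    by (rule transI) (auto simp: mcalister_equiv_def intro: pre_trans)
qed

lemma cls_in_poset: "g \<in> carrier GI \<Longrightarrow> e \<in> idems S \<Longrightarrow> cls g e \<in> mcalister_poset S"
  by (simp add: mcalister_poset_def quotientI)

lemma posetE:
  assumes "P \<in> mcalister_poset S"
  obtains g e where "g \<in> carrier GI" "e \<in> idems S" "P = cls g e"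
  using assms by (auto simp: mcalister_poset_def quotient_def)

lemma le_cls_iff:
  assumes "g \<in> carrier GI" "e \<in> idems S" "h \<in> carrier GI" "f \<in> idems S"
  shows "mcalister_le S (cls g e) (cls h f) \<longleftrightarrow> ((g, e), (h, f)) \<in> pre"
proof
  assume "mcalister_le S (cls g e) (cls h f)"
  then obtain p q where "((g, e), p) \<in> pre" "(p, q) \<in> pre" "(q, (h, f)) \<in> pre"
    by (auto simp: mcalister_le_def mcalister_equiv_def)
  then show "((g, e), (h, f)) \<in> pre"
    using pre_trans by metis
next
  have "(g, e) \<in> cls g e" "(h, f) \<in> cls h f"
    using equiv_class_self[OF equiv_mcalister] assms by auto
  moreover assume "((g, e), (h, f)) \<in> pre"
  ultimately show "mcalister_le S (cls g e) (cls h f)"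
    unfolding mcalister_le_def by blast
qed

lemma le_trans:
  assumes "mcalister_le S P Q" "mcalister_le S Q R"
    "P \<in> mcalister_poset S" "Q \<in> mcalister_poset S" "R \<in> mcalister_poset S"
  shows "mcalister_le S P R"
  using assms by (auto elim!: posetE simp: le_cls_iff intro: pre_trans)

section \<open>Translation of the poset by the group\<close>

lemma pre_translate:
  assumes "k \<in> carrier GI" "g \<in> carrier GI" "e \<in> idems S" "h \<in> carrier GI" "f \<in> idems S"
  shows "((k \<otimes>\<^bsub>GI\<^esub> g, e), (k \<otimes>\<^bsub>GI\<^esub> h, f)) \<in> pre \<longleftrightarrow> ((g, e), (h, f)) \<in> pre"
proof -
  have "k \<otimes>\<^bsub>GI\<^esub> g \<otimes>\<^bsub>GI\<^esub> sig s = k \<otimes>\<^bsub>GI\<^esub> h \<longleftrightarrow> g \<otimes>\<^bsub>GI\<^esub> sig s = h" if "s \<in> carrier S" for s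
    using assms that by (simp add: G.m_assoc)
  then show ?thesis
    using assms by (simp add: pre_iff)
qed

lemma act_cls:
  assumes k: "k \<in> carrier GI" and g: "g \<in> carrier GI" and e: "e \<in> idems S"
  shows "mcalister_act S k (cls g e) = cls (k \<otimes>\<^bsub>GI\<^esub> g) e"
proof (intro Set.set_eqI iffI)
  fix p assume "p \<in> mcalister_act S k (cls g e)"
  then obtain h f where "p = (k \<otimes>\<^bsub>GI\<^esub> h, f)" "((g, e), (h, f)) \<in> mcalister_equiv S"
    by (auto simp: mcalister_act_def)
  then show "p \<in> cls (k \<otimes>\<^bsub>GI\<^esub> g) e"
    using assms pre_translate[OF k] pre_closed[of "(g, e)" "(h, f)"]
    by (auto simp: mcalister_equiv_def)
next
  fix p assume p: "p \<in> cls (k \<otimes>\<^bsub>GI\<^esub> g) e"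
  obtain h f where hf: "p = (h, f)" by fastforce
  have h: "h \<in> carrier GI" and f: "f \<in> idems S"
    using p pre_closed by (fastforce simp: hf mcalister_equiv_def)+
  define h' where "h' = inv\<^bsub>GI\<^esub> k \<otimes>\<^bsub>GI\<^esub> h"
  have h': "h' \<in> carrier GI" "h = k \<otimes>\<^bsub>GI\<^esub> h'"
    using k h by (simp_all add: h'_def G.m_assoc[symmetric])
  then have "(h', f) \<in> cls g e"
    using p k g e f pre_translate by (auto simp: hf mcalister_equiv_def)
  then show "p \<in> mcalister_act S k (cls g e)"
    unfolding mcalister_act_def hf h'(2) by (rule rev_image_eqI) simp
qed

lemma act_poset:
  "k \<in> carrier GI \<Longrightarrow> P \<in> mcalister_poset S \<Longrightarrow> mcalister_act S k P \<in> mcalister_poset S"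
  by (erule posetE) (simp add: act_cls cls_in_poset)

lemma act_mult:
  "k \<in> carrier GI \<Longrightarrow> l \<in> carrier GI \<Longrightarrow> P \<in> mcalister_poset S \<Longrightarrow>
   mcalister_act S (k \<otimes>\<^bsub>GI\<^esub> l) P = mcalister_act S k (mcalister_act S l P)"
  by (erule posetE) (simp add: act_cls G.m_assoc)

lemma act_one: "P \<in> mcalister_poset S \<Longrightarrow> mcalister_act S \<one>\<^bsub>GI\<^esub> P = P"
  by (erule posetE) (simp add: act_cls)

lemma act_inv_cancel:
  assumes "k \<in> carrier GI" "P \<in> mcalister_poset S"
  shows "mcalister_act S k (mcalister_act S (inv\<^bsub>GI\<^esub> k) P) = P"
    and "mcalister_act S (inv\<^bsub>GI\<^esub> k) (mcalister_act S k P) = P"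
  using assms by (simp_all add: act_mult[symmetric] act_one)

lemma act_le:
  "k \<in> carrier GI \<Longrightarrow> P \<in> mcalister_poset S \<Longrightarrow> Q \<in> mcalister_poset S \<Longrightarrow>
   mcalister_le S (mcalister_act S k P) (mcalister_act S k Q) \<longleftrightarrow> mcalister_le S P Q"
  by (elim posetE) (simp add: act_cls le_cls_iff pre_translate)

lemma act_image_Int:
  assumes "k \<in> carrier GI" "I \<subseteq> mcalister_poset S" "J \<subseteq> mcalister_poset S"
  shows "mcalister_act S k ` (I \<inter> J) = mcalister_act S k ` I \<inter> mcalister_act S k ` J"
proof (rule inj_on_image_Int[OF _ assms(2,3)])
  show "inj_on (mcalister_act S k) (mcalister_poset S)"
    by (rule inj_on_inverseI[where g = "mcalister_act S (inv\<^bsub>GI\<^esub> k)"])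
      (simp add: act_inv_cancel assms)
qed

section \<open>The semilattice of order ideals and the action on it\<close>

abbreviation OS where "OS \<equiv> ocarroll_semilattice S"

lemma OS_iff: "I \<in> carrier OS \<longleftrightarrow> I \<subseteq> mcalister_poset S \<and>
    (\<forall>Q\<in>I. \<forall>P\<in>mcalister_poset S. mcalister_le S P Q \<longrightarrow> P \<in> I)"
  by (simp add: ocarroll_semilattice_def)

lemma OS_mult [simp]: "I \<cdot>\<^bsub>OS\<^esub> J = I \<inter> J"
  by (simp add: ocarroll_semilattice_def)

lemma meet_semilattice_OS: "meet_semilattice OS"
proof -
  have "{} \<in> carrier OS" by (simp add: OS_iff)
  then have "carrier OS \<noteq> {}" by blast
  moreover have "I \<inter> J \<in> carrier OS" if "I \<in> carrier OS" "J \<in> carrier OS" for I J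
    using that unfolding OS_iff by blast
  ultimately show ?thesis
    by (auto simp: meet_semilattice_def semigroup_on_carrier_def)
qed

lemma act_OS:
  assumes k: "k \<in> carrier GI" and I: "I \<in> carrier OS"
  shows "mcalister_act S k ` I \<in> carrier OS"
  unfolding OS_iff
proof (intro conjI ballI impI)
  show "mcalister_act S k ` I \<subseteq> mcalister_poset S"
    using I act_poset[OF k] by (auto simp: OS_iff)
  fix Q P assume Q: "Q \<in> mcalister_act S k ` I" and P: "P \<in> mcalister_poset S"
    and le: "mcalister_le S P Q"
  from Q obtain R where R: "R \<in> I" "Q = mcalister_act S k R" by blast
  define P' where "P' = mcalister_act S (inv\<^bsub>GI\<^esub> k) P"
  have P': "P' \<in> mcalister_poset S" "P = mcalister_act S k P'"
    using k P by (simp_all add: P'_def act_poset act_inv_cancel)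
  have "R \<in> mcalister_poset S"
    using I R by (auto simp: OS_iff)
  then have "mcalister_le S P' R"
    using le P' R k by (simp add: act_le)
  then have "P' \<in> I"
    using I R P' by (auto simp: OS_iff)
  then show "P \<in> mcalister_act S k ` I"
    using P' by blast
qed

lemma ocarroll_action_apply:
  "I \<in> carrier OS \<Longrightarrow> ocarroll_action S k I = mcalister_act S k ` I"
  by (simp add: ocarroll_action_def)

lemma ocarroll_action_mult:
  assumes "k \<in> carrier GI" "l \<in> carrier GI" "I \<in> carrier OS"
  shows "ocarroll_action S (k \<otimes>\<^bsub>GI\<^esub> l) I = ocarroll_action S k (ocarroll_action S l I)"
proof -
  have "mcalister_act S (k \<otimes>\<^bsub>GI\<^esub> l) P = mcalister_act S k (mcalister_act S l P)" if "P \<in> I" for P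
    using assms that by (intro act_mult) (auto simp: OS_iff)
  then show ?thesis
    using assms by (simp add: ocarroll_action_apply act_OS image_image)
qed

lemma ocarroll_action_one:
  assumes "I \<in> carrier OS"
  shows "ocarroll_action S \<one>\<^bsub>GI\<^esub> I = I"
proof -
  have "mcalister_act S \<one>\<^bsub>GI\<^esub> P = P" if "P \<in> I" for P
    using assms that by (intro act_one) (auto simp: OS_iff)
  then show ?thesis
    using assms by (simp add: ocarroll_action_apply)
qed

lemma ocarroll_action_Bij:
  assumes k: "k \<in> carrier GI"
  shows "ocarroll_action S k \<in> Bij (carrier OS)"
proof -
  have k': "inv\<^bsub>GI\<^esub> k \<in> carrier GI" using k by simp
  have into: "ocarroll_action S l I \<in> carrier OS" if "l \<in> carrier GI" "I \<in> carrier OS" for l I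
    using that by (simp add: ocarroll_action_apply act_OS)
  have "bij_betw (ocarroll_action S k) (carrier OS) (carrier OS)"
  proof (rule bij_betw_byWitness[where f' = "ocarroll_action S (inv\<^bsub>GI\<^esub> k)"])
    show "\<forall>I\<in>carrier OS. ocarroll_action S (inv\<^bsub>GI\<^esub> k) (ocarroll_action S k I) = I"
      using ocarroll_action_mult[OF k' k] ocarroll_action_one k by simp
    show "\<forall>I\<in>carrier OS. ocarroll_action S k (ocarroll_action S (inv\<^bsub>GI\<^esub> k) I) = I"
      using ocarroll_action_mult[OF k k'] ocarroll_action_one k by simp
  qed (use into k k' in auto)
  then show ?thesis
    by (simp add: Bij_def ocarroll_action_def)
qed

lemma semilattice_action_ocarroll: "semilattice_action GI OS (ocarroll_action S)"
  unfolding semilattice_action_def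
proof (intro conjI group_GI meet_semilattice_OS homI)
  fix k assume k: "k \<in> carrier GI"
  have "ocarroll_action S k \<in> sgrp_hom OS OS"
  proof -
    have "mcalister_act S k ` (I \<inter> J) = mcalister_act S k ` I \<inter> mcalister_act S k ` J"
      if "I \<in> carrier OS" "J \<in> carrier OS" for I J
      using that k by (intro act_image_Int) (auto simp: OS_iff)
    moreover have "I \<inter> J \<in> carrier OS" if "I \<in> carrier OS" "J \<in> carrier OS" for I J
      using that meet_semilattice_OS
      by (auto simp: meet_semilattice_def semigroup_on_carrier_def)
    ultimately show ?thesis
      using k by (simp add: sgrp_hom_def ocarroll_action_apply act_OS)
  qed
  then show "ocarroll_action S k \<in> carrier (semilattice_Aut OS)"
    using ocarroll_action_Bij[OF k] by (simp add: semilattice_Aut_def)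
  fix l assume l: "l \<in> carrier GI"
  show "ocarroll_action S (k \<otimes>\<^bsub>GI\<^esub> l) =
      ocarroll_action S k \<otimes>\<^bsub>semilattice_Aut OS\<^esub> ocarroll_action S l"
  proof
    fix I
    show "ocarroll_action S (k \<otimes>\<^bsub>GI\<^esub> l) I =
      (ocarroll_action S k \<otimes>\<^bsub>semilattice_Aut OS\<^esub> ocarroll_action S l) I"
    \<comment> \<open>Members of \<open>Bij\<close> are \<open>undefined\<close> off the carrier,
      and equality of functions has to be checked there as well.\<close>
    proof (cases "I \<in> carrier OS")
      case True
      then show ?thesis
        using k l ocarroll_action_Bij
        by (simp add: ocarroll_action_mult semilattice_Aut_def BijGroup_def compose_def)
    next
      case False
      then show ?thesis
        using k l ocarroll_action_Bij
        by (simp add: semilattice_Aut_def BijGroup_def compose_def ocarroll_action_def)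
    qed
  qed
qed

section \<open>Principal ideals and the embedding\<close>

definition ideal_below where
  "ideal_below Q = {P \<in> mcalister_poset S. mcalister_le S P Q}"

lemma ideal_below_OS: "Q \<in> mcalister_poset S \<Longrightarrow> ideal_below Q \<in> carrier OS"
  using le_trans by (auto simp: ideal_below_def OS_iff)

lemma act_ideal_below:
  assumes k: "k \<in> carrier GI" and Q: "Q \<in> mcalister_poset S"
  shows "mcalister_act S k ` ideal_below Q = ideal_below (mcalister_act S k Q)"
proof (intro Set.set_eqI iffI)
  fix P assume "P \<in> mcalister_act S k ` ideal_below Q"
  then show "P \<in> ideal_below (mcalister_act S k Q)"
    using k Q by (auto simp: ideal_below_def act_le act_poset)
next
  fix P assume P: "P \<in> ideal_below (mcalister_act S k Q)"
  define P' where "P' = mcalister_act S (inv\<^bsub>GI\<^esub> k) P"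
  have P': "P' \<in> mcalister_poset S" "P = mcalister_act S k P'"
    using k P by (simp_all add: P'_def ideal_below_def act_poset act_inv_cancel)
  then have "P' \<in> ideal_below Q"
    using P k Q by (simp add: ideal_below_def act_le)
  then show "P \<in> mcalister_act S k ` ideal_below Q"
    using P' by blast
qed

lemma ocarroll_map_eq:
  "ocarroll_map S s = (ideal_below (cls \<one>\<^bsub>GI\<^esub> (s \<cdot> iv s)), sig s)"
  by (simp add: ocarroll_map_def ideal_below_def)

text \<open>This is the product rule in the semilattice coordinate. A point below both generators
  has witnesses \<open>p\<close> and \<open>q\<close>; once \<open>p \<cdot> s = q\<close> is known,
  \<open>p\<close> absorbs the range idempotent of \<open>s \<cdot> t\<close>, so \<open>p\<close>
  also witnesses the relation to the third generator.\<close>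

lemma ideal_below_mult:
  assumes E: "e_unitary S" and s: "s \<in> carrier S" and t: "t \<in> carrier S"
  shows "ideal_below (cls \<one>\<^bsub>GI\<^esub> (s \<cdot> iv s)) \<inter> ideal_below (cls (sig s) (t \<cdot> iv t)) =
    ideal_below (cls \<one>\<^bsub>GI\<^esub> (s \<cdot> t \<cdot> iv (s \<cdot> t)))" (is "?L = ?R")
proof (intro Set.set_eqI iffI)
  note one = G.one_closed
  have 1: "((\<one>\<^bsub>GI\<^esub>, s \<cdot> t \<cdot> iv (s \<cdot> t)), (\<one>\<^bsub>GI\<^esub>, s \<cdot> iv s)) \<in> pre"
  proof -
    have "s \<cdot> t \<cdot> iv (s \<cdot> t) \<cdot> (s \<cdot> iv s) = s \<cdot> t \<cdot> iv (s \<cdot> t)"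
      using s t by (simp add: assoc iv_mult iv_simps)
    then have "nat_le S (s \<cdot> t \<cdot> iv (s \<cdot> t)) (s \<cdot> iv s)"
      using s t by (simp add: nat_le_idem_iff)
    then show ?thesis
      by (rule pre_idem_le[rotated 2]) (use s t in simp_all)
  qed
  have 2: "((\<one>\<^bsub>GI\<^esub>, s \<cdot> t \<cdot> iv (s \<cdot> t)), (sig s, t \<cdot> iv t)) \<in> pre"
  proof -
    \<comment> \<open>\<open>r\<close> is a restriction of \<open>s\<close>: it keeps the group
      image of \<open>s\<close>, has the range idempotent of \<open>s \<cdot> t\<close>, and its
      domain idempotent \<open>iv r \<cdot> r\<close> lies below
      \<open>t \<cdot> iv t\<close>.\<close>
    define r where "r = s \<cdot> (t \<cdot> iv t)"
    have r: "r \<in> carrier S" "r \<cdot> iv r = s \<cdot> t \<cdot> iv (s \<cdot> t)"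
      "iv r \<cdot> r = (t \<cdot> iv t \<cdot> (iv s \<cdot> s)) \<cdot> (t \<cdot> iv t)"
      using s t by (simp_all add: r_def iv_mult assoc iv_simps)
    have "nat_le S (iv r \<cdot> r) (t \<cdot> iv t)"
      unfolding r(3) by (rule nat_le_mult_idem_idem) (use s t in \<open>simp_all add: idem_mult\<close>)
    moreover have "sig r = sig s"
      using s t by (simp add: r_def sig_mult[symmetric, of s] sig_idem)
    ultimately show ?thesis
      using s t r by (auto simp: pre_iff intro!: bexI[of _ r])
  qed
  fix P
  show "P \<in> ?L" if "P \<in> ?R"
    using that 1 2 s t
    by (auto simp: ideal_below_def elim!: posetE simp: le_cls_iff intro: pre_trans)
  assume P: "P \<in> ?L"
  then obtain g e where ge: "g \<in> carrier GI" "e \<in> idems S" "P = cls g e"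
    by (auto simp: ideal_below_def elim: posetE)
  have "((g, e), (\<one>\<^bsub>GI\<^esub>, s \<cdot> iv s)) \<in> pre" "((g, e), (sig s, t \<cdot> iv t)) \<in> pre"
    using P ge s t by (auto simp: ideal_below_def le_cls_iff)
  then obtain p q where p: "p \<in> carrier S" "g \<otimes>\<^bsub>GI\<^esub> sig p = \<one>\<^bsub>GI\<^esub>" "p \<cdot> iv p = e"
      "nat_le S (iv p \<cdot> p) (s \<cdot> iv s)"
    and q: "q \<in> carrier S" "g \<otimes>\<^bsub>GI\<^esub> sig q = sig s" "q \<cdot> iv q = e" "nat_le S (iv q \<cdot> q) (t \<cdot> iv t)"
    using ge s t by (auto simp: pre_iff)
  have p4: "iv p \<cdot> p \<cdot> (s \<cdot> iv s) = iv p \<cdot> p"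
    using p s by (simp add: nat_le_idem_iff)
  have q4: "iv q \<cdot> q \<cdot> (t \<cdot> iv t) = iv q \<cdot> q"
    using q t by (simp add: nat_le_idem_iff)
  have p4': "p \<cdot> (s \<cdot> iv s) = p"
    using p4 p s by (metis assoc mult_iv_mult closed iv_closed)
  \<comment> \<open>Here \<open>E\<close>-unitarity enters.\<close>
  have ps: "p \<cdot> s = q"
  proof (rule e_unitary_eqI[OF E])
    have "g \<otimes>\<^bsub>GI\<^esub> sig (p \<cdot> s) = g \<otimes>\<^bsub>GI\<^esub> sig q"
      using p q ge s by (simp add: sig_mult[symmetric] G.m_assoc[symmetric])
    then show "sig (p \<cdot> s) = sig q"
      by (rule G.Units_l_cancel[THEN iffD1, rotated -1]) (use p(1) q(1) ge(1) s in auto)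
    have "p \<cdot> s \<cdot> iv (p \<cdot> s) = p \<cdot> (s \<cdot> iv s) \<cdot> iv p"
      using p(1) s by (simp add: iv_mult assoc)
    then show "p \<cdot> s \<cdot> iv (p \<cdot> s) = q \<cdot> iv q"
      using p q by (simp add: p4')
  qed (use p q s in auto)
  have "iv p \<cdot> p \<cdot> (s \<cdot> t \<cdot> iv (s \<cdot> t)) = iv p \<cdot> p"
  proof -
    have "p \<cdot> (s \<cdot> t \<cdot> iv (s \<cdot> t)) = q \<cdot> (t \<cdot> iv t) \<cdot> iv s"
      using p(1) s t by (simp add: ps[symmetric] iv_mult assoc)
    also have "q \<cdot> (t \<cdot> iv t) = q"
      using q4 q t by (metis assoc mult_iv_mult closed iv_closed)
    also have "q \<cdot> iv s = p"
      using p4' p s by (simp add: ps[symmetric] assoc)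
    finally show ?thesis
      using p s t by (simp add: assoc)
  qed
  then have "nat_le S (iv p \<cdot> p) (s \<cdot> t \<cdot> iv (s \<cdot> t))"
    using p s t by (simp add: nat_le_idem_iff)
  then have "((g, e), (\<one>\<^bsub>GI\<^esub>, s \<cdot> t \<cdot> iv (s \<cdot> t))) \<in> pre"
    using p ge s t by (auto simp: pre_iff)
  then show "P \<in> ?R"
    using P ge s t by (auto simp: ideal_below_def le_cls_iff)
qed

lemma ocarroll_embedding:
  assumes E: "e_unitary S"
  shows "sgrp_embedding S (ocarroll_product S) (ocarroll_map S)"
proof -
  have c1: "cls \<one>\<^bsub>GI\<^esub> (s \<cdot> iv s) \<in> mcalister_poset S" if "s \<in> carrier S" for s
    using that by (simp add: cls_in_poset)
  have "ocarroll_map S \<in> sgrp_hom S (ocarroll_product S)"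
  proof -
    have "ocarroll_map S s \<in> carrier (ocarroll_product S)" if "s \<in> carrier S" for s
      using that c1[OF that]
      by (simp add: ocarroll_map_eq ocarroll_product_def semidirect_product_def ideal_below_OS)
    moreover have "ocarroll_map S (s \<cdot> t) =
        ocarroll_map S s \<cdot>\<^bsub>ocarroll_product S\<^esub> ocarroll_map S t"
      if s: "s \<in> carrier S" and t: "t \<in> carrier S" for s t
    proof -
      have "ocarroll_action S (sig s) (ideal_below (cls \<one>\<^bsub>GI\<^esub> (t \<cdot> iv t))) =
          ideal_below (cls (sig s) (t \<cdot> iv t))"
        using s t c1[OF t]
        by (simp add: ocarroll_action_apply ideal_below_OS act_ideal_below act_cls)
      then show ?thesis
        using ideal_below_mult[OF E s t] s t
        by (simp add: ocarroll_map_eq ocarroll_product_def semidirect_product_def sig_mult)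
    qed
    ultimately show ?thesis
      by (simp add: sgrp_hom_def)
  qed
  moreover have "inj_on (ocarroll_map S) (carrier S)"
  proof (rule inj_onI)
    fix s t assume s: "s \<in> carrier S" and t: "t \<in> carrier S"
      and eq: "ocarroll_map S s = ocarroll_map S t"
    \<comment> \<open>A principal ideal contains its generator, so equal ideals have comparable
      generators. The witness \<open>r\<close> of this comparison lies over the identity, so
      E-unitarity makes it idempotent and its range and domain idempotents coincide.\<close>
    have le: "nat_le S (s \<cdot> iv s) (t \<cdot> iv t)"
      if s: "s \<in> carrier S" and t: "t \<in> carrier S" and eq: "ocarroll_map S s = ocarroll_map S t"
      for s t
    proof -
      have "cls \<one>\<^bsub>GI\<^esub> (s \<cdot> iv s) \<in> ideal_below (cls \<one>\<^bsub>GI\<^esub> (s \<cdot> iv s))"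
        using s by (simp add: ideal_below_def c1 le_cls_iff pre_refl)
      then have "cls \<one>\<^bsub>GI\<^esub> (s \<cdot> iv s) \<in> ideal_below (cls \<one>\<^bsub>GI\<^esub> (t \<cdot> iv t))"
        using eq by (simp add: ocarroll_map_eq)
      then have "((\<one>\<^bsub>GI\<^esub>, s \<cdot> iv s), (\<one>\<^bsub>GI\<^esub>, t \<cdot> iv t)) \<in> pre"
        using s t by (simp add: ideal_below_def le_cls_iff)
      then obtain r where r: "r \<in> carrier S" "sig r = \<one>\<^bsub>GI\<^esub>" "r \<cdot> iv r = s \<cdot> iv s"
        "nat_le S (iv r \<cdot> r) (t \<cdot> iv t)"
        using s t by (auto simp: pre_iff)
      then have "r \<in> idems S"
        using e_unitary_sig_one[OF E] by blast
      then show ?thesis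
        using r by (simp add: idemsD)
    qed
    have "s \<cdot> iv s = t \<cdot> iv t"
      using le[OF s t eq] le[OF t s eq[symmetric]] s t by (intro nat_le_antisym_idem) simp_all
    then show "s = t"
      using e_unitary_eqI[OF E s t] eq by (simp add: ocarroll_map_eq)
  qed
  ultimately show ?thesis
    by (simp add: sgrp_embedding_def)
qed

end

section \<open>Free reduction of words\<close>

definition linv :: "'x \<times> bool \<Rightarrow> 'x \<times> bool" where
  "linv a = (fst a, \<not> snd a)"

lemma linv_linv [simp]: "linv (linv a) = a"
  by (simp add: linv_def)

lemma linv_neq [simp]: "linv a \<noteq> a" "a \<noteq> linv a"
  by (auto simp: linv_def prod_eq_iff)

lemma linv_Pair [simp]: "linv (x, b) = (x, \<not> b)"
  by (simp add: linv_def)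

lemma word_inv_simps [simp]:
  "word_inv [] = []" "word_inv (a # w) = word_inv w @ [linv a]"
  by (auto simp: word_inv_def linv_def split: prod.splits)

lemma word_inv_append [simp]: "word_inv (u @ v) = word_inv v @ word_inv u"
  by (simp add: word_inv_def)

lemma word_inv_word_inv [simp]: "word_inv (word_inv w) = w"
  by (induction w) auto

lemma word_inv_eq_Nil [simp]: "word_inv w = [] \<longleftrightarrow> w = []"
  by (simp add: word_inv_def)

lemma words_Nil [simp]: "[] \<in> words X"
  and words_Cons [simp]: "a # w \<in> words X \<longleftrightarrow> fst a \<in> X \<and> w \<in> words X"
  and words_append [simp]: "u @ v \<in> words X \<longleftrightarrow> u \<in> words X \<and> v \<in> words X"
  by (auto simp: words_def mem_Times_iff)

lemma words_UNIV: "w \<in> words UNIV"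
  by (simp add: words_def)

lemma words_word_inv [simp]: "word_inv w \<in> words X \<longleftrightarrow> w \<in> words X"
  by (induction w) (auto simp: linv_def)

fun rcons :: "'x \<times> bool \<Rightarrow> 'x word \<Rightarrow> 'x word" where
  "rcons a [] = [a]"
| "rcons a (b # w) = (if b = linv a then w else a # b # w)"

definition red :: "'x word \<Rightarrow> 'x word" where
  "red w = foldr rcons w []"

fun reduced :: "'x word \<Rightarrow> bool" where
  "reduced [] \<longleftrightarrow> True"
| "reduced [a] \<longleftrightarrow> True"
| "reduced (a # b # w) \<longleftrightarrow> b \<noteq> linv a \<and> reduced (b # w)"

lemma red_simps [simp]: "red [] = []" "red (a # w) = rcons a (red w)"
  by (simp_all add: red_def)

lemma reduced_tl: "reduced (a # w) \<Longrightarrow> reduced w"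
  by (cases w) auto

lemma reduced_rcons: "reduced w \<Longrightarrow> reduced (rcons a w)"
  by (cases w) (auto dest: reduced_tl)

lemma reduced_foldr: "reduced r \<Longrightarrow> reduced (foldr rcons w r)"
  by (induction w) (auto intro: reduced_rcons)

lemma reduced_red [simp]: "reduced (red w)"
  by (simp add: red_def reduced_foldr)

lemma rcons_reduced: "reduced (a # w) \<Longrightarrow> rcons a w = a # w"
  by (cases w) auto

lemma red_reduced: "reduced w \<Longrightarrow> red w = w"
proof (induction w)
  case (Cons a w)
  then show ?case
    using reduced_tl[of a w] rcons_reduced[of a w] by simp
qed simp

lemma red_red [simp]: "red (red w) = red w"
  by (simp add: red_reduced)

text \<open>Reducedness matters when \<open>w\<close> begins with \<open>a\<close>: the inner
  \<open>rcons\<close> strips that letter, and the rest must not begin with \<open>linv a\<close> if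
  \<open>a\<close> is to be put back.\<close>

lemma rcons_cancel:
  assumes "reduced w"
  shows "rcons a (rcons (linv a) w) = w"
proof (cases w)
  case (Cons b v)
  then show ?thesis
    using assms rcons_reduced[of b v] by auto
qed simp

lemma foldr_word_inv: "reduced r \<Longrightarrow> foldr rcons (word_inv w) (foldr rcons w r) = r"
proof (induction w)
  case (Cons a w)
  then show ?case
    using rcons_cancel[of "foldr rcons w r" "linv a"] by (simp add: reduced_foldr)
qed simp

lemma red_word_inv_left [simp]: "red (word_inv w @ w) = []"
  using foldr_word_inv[of "[]" w] by (simp add: red_def)

lemma red_word_inv_right [simp]: "red (w @ word_inv w) = []"
  using red_word_inv_left[of "word_inv w"] by simp

lemma set_rcons: "set (rcons a w) \<subseteq> insert a (set w)"
  by (cases w) auto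

lemma set_red: "set (red w) \<subseteq> set w"
  by (induction w) (use set_rcons in fastforce)+

lemma words_red: "w \<in> words X \<Longrightarrow> red w \<in> words X"
  using set_red[of w] by (auto simp: words_def lists_eq_set)

lemma free_group_cong_words: "(u, v) \<in> free_group_cong X \<Longrightarrow> u \<in> words X \<and> v \<in> words X"
  by (induction rule: free_group_cong.induct) auto

text \<open>Van der Waerden's argument: letters act on the reduced words, a letter and its inverse
  act as mutually inverse maps, so congruent words act equally. Applied to the empty word it gives
  uniqueness of reduced forms.\<close>

lemma free_group_cong_foldr:
  "(u, v) \<in> free_group_cong X \<Longrightarrow> reduced r \<Longrightarrow> foldr rcons u r = foldr rcons v r"
proof (induction arbitrary: r rule: free_group_cong.induct)
  case (compat u u' v v')
  then show ?case by (simp add: reduced_foldr)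
next
  case (cancel x b)
  then show ?case
    using rcons_cancel[of r "(x, b)"] by simp
qed auto

lemma free_group_cong_red: "w \<in> words X \<Longrightarrow> (w, red w) \<in> free_group_cong X"
proof (induction w)
  case Nil
  then show ?case by (simp add: free_group_cong.refl)
next
  case (Cons a w)
  have a: "([a], [a]) \<in> free_group_cong X"
    using Cons.prems by (intro free_group_cong.refl) simp
  have "(a # w, a # red w) \<in> free_group_cong X"
    using free_group_cong.compat[OF a, of w "red w"] Cons by simp
  moreover have "(a # red w, rcons a (red w)) \<in> free_group_cong X"
  proof (cases "\<exists>v. red w = linv a # v")
    case True
    then obtain v where v: "red w = linv a # v" by blast
    have "([a, linv a], []) \<in> free_group_cong X"
      using free_group_cong.cancel[of "fst a" X "snd a"] Cons.prems by (simp add: linv_def)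
    moreover have "(v, v) \<in> free_group_cong X"
      using Cons.prems words_red[of w X] v by (intro free_group_cong.refl) simp
    ultimately show ?thesis
      using free_group_cong.compat[of "[a, linv a]" "[]" X v v] v by simp
  next
    case False
    then have "rcons a (red w) = a # red w"
      by (cases "red w") auto
    then show ?thesis
      using Cons.prems words_red[of w X] by (simp add: free_group_cong.refl)
  qed
  ultimately show ?case
    by (auto intro: free_group_cong.trans)
qed

theorem free_group_cong_iff:
  assumes "u \<in> words X" "v \<in> words X"
  shows "(u, v) \<in> free_group_cong X \<longleftrightarrow> red u = red v"
proof
  assume "(u, v) \<in> free_group_cong X"
  then show "red u = red v"
    using free_group_cong_foldr[of u v X "[]"] by (simp add: red_def)
next
  assume "red u = red v"
  then show "(u, v) \<in> free_group_cong X"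
    using free_group_cong_red assms by (metis free_group_cong.sym free_group_cong.trans)
qed

lemma red_append_cong: "red u = red u' \<Longrightarrow> red v = red v' \<Longrightarrow> red (u @ v) = red (u' @ v')"
  using free_group_cong.compat[of u u' UNIV v v']
  by (simp add: free_group_cong_iff words_UNIV)

text \<open>The path in the Cayley tree traced by the reduced form of \<open>w\<close> is part of the path traced
  by \<open>w\<close>.\<close>

lemma prefix_red:
  assumes "prefix p (red w)"
  shows "\<exists>q. prefix q w \<and> red q = red p"
  using assms
proof (induction w arbitrary: p)
  case (Cons a w)
  have "\<exists>q. prefix q w \<and> red (a # q) = red p" if ne: "p \<noteq> []"
  proof (cases "\<exists>v. red w = linv a # v")
    case True
    then obtain v where v: "red w = linv a # v" by blast
    \<comment> \<open>Here \<open>a\<close> cancels and \<open>p\<close> is a prefix of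
      \<open>v\<close>. The induction hypothesis is used for the longer \<open>linv a # p\<close>,
      and prepending \<open>a\<close> undoes the extra letter.\<close>
    then have "prefix (linv a # p) (red w)"
      using Cons.prems by simp
    then obtain q where "prefix q w" "red q = red (linv a # p)"
      using Cons.IH by blast
    then show ?thesis
      using rcons_cancel[of "red p" a] by auto
  next
    case False
    then have "rcons a (red w) = a # red w"
      by (cases "red w") auto
    then obtain p' where "p = a # p'" "prefix p' (red w)"
      using Cons.prems ne by (cases p) auto
    then show ?thesis
      using Cons.IH[of p'] by auto
  qed
  then show ?case
    by (cases "p = []") (force intro: exI[of _ "[]"] exI[of _ "a # _"])+
qed auto

text \<open>The first surviving letter is preceded only by a part that cancels. If the head
  \<open>b\<close> of \<open>w\<close> cancels, the hypothesis is used twice: for the tail, to find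
  the partner of \<open>b\<close>, and for what follows the partner, to find \<open>a\<close>. Hence
  the induction on length.\<close>

lemma red_eq_ConsE:
  assumes "red w = a # r"
  obtains u v where "w = u @ a # v" "red u = []" "red v = r"
proof -
  have "\<exists>u v. w = u @ a # v \<and> red u = [] \<and> red v = r"
    using assms
  proof (induction w arbitrary: a r rule: length_induct)
    case (1 w)
    from 1(2) obtain b w' where w: "w = b # w'"
      by (cases w) auto
    show ?case
    proof (cases "\<exists>v. red w' = linv b # v")
      case True
      then have "red w' = linv b # a # r"
        using 1(2) w by auto
      then obtain u1 v1 where 2: "w' = u1 @ linv b # v1" "red u1 = []" "red v1 = a # r"
        using 1(1)[rule_format, of w' "linv b" "a # r"] w by auto
      then obtain u2 v2 where 3: "v1 = u2 @ a # v2" "red u2 = []" "red v2 = r"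
        using 1(1)[rule_format, of v1 a r] w by auto
      have "red ((b # u1 @ [linv b]) @ u2) = []"
        using red_append_cong[of u1 "[]" "linv b # u2" "[linv b]"] 2 3 by simp
      moreover have "w = ((b # u1 @ [linv b]) @ u2) @ a # v2"
        using w 2 3 by simp
      ultimately show ?thesis
        using 3(3) by blast
    next
      case False
      then have "red w = b # red w'"
        using w by (cases "red w'") auto
      then show ?thesis
        using 1(2) w by (intro exI[of _ "[]"] exI[of _ w']) auto
    qed
  qed
  then show thesis using that by blast
qed

section \<open>Free groups\<close>

text \<open>The alphabet is kept apart from the group, whose elements may be of another type. The
  locale thus covers the maximum group image directly, with words over the generators of the inverse
  semigroup.\<close>

locale free_group_eval = group G for G (structure) +
  fixes X :: "'x set" and ev :: "'x word \<Rightarrow> 'a"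
  assumes ev_closed [simp, intro]: "w \<in> words X \<Longrightarrow> ev w \<in> carrier G"
    and ev_surj: "g \<in> carrier G \<Longrightarrow> \<exists>w\<in>words X. ev w = g"
    and ev_append: "u \<in> words X \<Longrightarrow> v \<in> words X \<Longrightarrow> ev (u @ v) = ev u \<otimes> ev v"
    and ev_eq_iff: "u \<in> words X \<Longrightarrow> v \<in> words X \<Longrightarrow> ev u = ev v \<longleftrightarrow> red u = red v"
begin

lemma ev_Nil [simp]: "ev [] = \<one>"
  using ev_append[of "[]" "[]"] ev_closed[of "[]"] by (simp del: ev_closed)

lemma ev_word_inv: "w \<in> words X \<Longrightarrow> ev (word_inv w) = inv (ev w)"
  by (rule inv_equality[symmetric])
    (simp_all add: ev_append[symmetric] ev_eq_iff flip: ev_Nil)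

lemma ev_red: "w \<in> words X \<Longrightarrow> ev (red w) = ev w"
  by (simp add: ev_eq_iff words_red)

subsection \<open>Howson's theorem\<close>

text \<open>The vertices of the core of the Schreier graph of \<open>H\<close>.\<close>

definition core :: "'a set \<Rightarrow> 'a set set" where
  "core H = {H #> ev p | p w. w \<in> words X \<and> reduced w \<and> ev w \<in> H \<and> prefix p w}"

text \<open>The alphabet may be infinite, so a finite vertex set alone does not bound the edges of
  the core; their labels are recorded separately.\<close>

definition letters_of :: "'a set \<Rightarrow> ('x \<times> bool) set" where
  "letters_of H = \<Union> {set w | w. w \<in> words X \<and> reduced w \<and> ev w \<in> H}"

lemma prefix_words: "prefix p w \<Longrightarrow> w \<in> words X \<Longrightarrow> p \<in> words X"
  by (auto elim!: prefixE)

lemma prefix_concat: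
  assumes "prefix q (concat ws)"
  obtains vs r where "set vs \<subseteq> set ws" "q = concat vs @ r" "r = [] \<or> (\<exists>w\<in>set ws. prefix r w)"
  using assms
proof (induction ws arbitrary: q thesis)
  case Nil
  then show ?case by auto
next
  case (Cons w ws)
  from Cons.prems(2) consider "prefix q w" | r where "q = w @ r" "prefix r (concat ws)"
    by (auto simp: prefix_append)
  then show ?case
  proof cases
    case 1
    then show ?thesis
      by (intro Cons.prems(1)[of "[]" q]) auto
  next
    case 2
    then obtain vs r' where "set vs \<subseteq> set ws" "r = concat vs @ r'"
      "r' = [] \<or> (\<exists>w\<in>set ws. prefix r' w)"
      using Cons.IH by metis
    then show ?thesis
      using 2 by (intro Cons.prems(1)[of "w # vs" r']) auto
  qed
qed

lemma generate_words:
  assumes A: "A \<subseteq> carrier G" and h: "h \<in> generate G A"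
    and W: "W \<subseteq> words X" "word_inv ` W \<subseteq> W" "A \<subseteq> ev ` W"
  shows "\<exists>ws. set ws \<subseteq> W \<and> ev (concat ws) = h"
  using h
proof (induction rule: generate.induct)
  case one
  then show ?case by (intro exI[of _ "[]"]) simp
next
  case (incl h)
  then obtain w where "w \<in> W" "ev w = h" using W by blast
  then show ?case by (intro exI[of _ "[w]"]) simp
next
  case (inv h)
  then obtain w where "w \<in> W" "ev w = h" using W by blast
  then show ?case
    using W by (intro exI[of _ "[word_inv w]"]) (auto simp: ev_word_inv)
next
  case (eng h1 h2)
  then obtain us vs where *: "set us \<subseteq> W" "ev (concat us) = h1" "set vs \<subseteq> W" "ev (concat vs) = h2"
    by blast
  have "concat ws \<in> words X" if "set ws \<subseteq> W" for ws
    using that W(1) by (induction ws) auto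
  then show ?case
    using * by (intro exI[of _ "us @ vs"]) (simp add: ev_append)
qed

text \<open>By \<open>prefix_red\<close>, each vertex of the core is reached by a prefix of a
  product of generator words. The complete factors of this prefix evaluate into \<open>H\<close> and
  vanish in the coset, leaving a prefix of a single generator word. Letters are bounded because
  reduction introduces none.\<close>

lemma fin_gen_imp_core_finite:
  assumes "fin_gen_subgroup H G"
  shows "finite (core H)" "finite (letters_of H)"
proof -
  from assms obtain A where H: "subgroup H G" and A: "finite A" "A \<subseteq> carrier G" "H = generate G A"
    by (auto simp: fin_gen_subgroup_def)
  obtain wd where wd: "\<And>a. a \<in> A \<Longrightarrow> wd a \<in> words X \<and> ev (wd a) = a"
    using ev_surj A(2) by (metis subsetD)
  define W where "W = wd ` A \<union> (word_inv \<circ> wd) ` A"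
  have W: "finite W" "W \<subseteq> words X" "word_inv ` W \<subseteq> W" "A \<subseteq> ev ` W"
    using A(1) wd by (auto simp: W_def image_image) (metis UnI1 image_eqI)
  have W_H: "ev w \<in> H" if "w \<in> W" for w
    using that wd A(3) H by (auto simp: W_def ev_word_inv intro: generate.intros)
  have concat_words: "concat ws \<in> words X" if "set ws \<subseteq> W" for ws
    using that W(2) by (induction ws) auto
  have concat_H: "ev (concat ws) \<in> H" if "set ws \<subseteq> W" for ws
    using that
  proof (induction ws)
    case Nil
    then show ?case using H by (simp add: subgroup.one_closed)
  next
    case (Cons w ws)
    then show ?case
      using W(2) W_H H concat_words[of ws] by (auto simp: ev_append subgroup.m_closed)
  qed
  have word_rep: "\<exists>ws. set ws \<subseteq> W \<and> w = red (concat ws)"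
    if "w \<in> words X" "reduced w" "ev w \<in> H" for w
  proof -
    have "ev w \<in> generate G A"
      using that A(3) by simp
    from generate_words[OF A(2) this W(2-4)]
    obtain ws where ws: "set ws \<subseteq> W" "ev (concat ws) = ev w"
      by blast
    then have "red (concat ws) = red w"
      using ev_eq_iff concat_words that by blast
    then show ?thesis
      using ws that by (auto simp: red_reduced)
  qed
  define Pf where "Pf = insert [] (\<Union>w\<in>W. set (prefixes w))"
  have "finite Pf"
    using W by (simp add: Pf_def)
  moreover have "core H \<subseteq> (\<lambda>r. H #> ev r) ` Pf"
  proof
    fix c assume "c \<in> core H"
    then obtain p w where c: "c = H #> ev p" and w: "w \<in> words X" "reduced w" "ev w \<in> H"
      and p: "prefix p w"
      by (auto simp: core_def)
    obtain ws where ws: "set ws \<subseteq> W" "w = red (concat ws)"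
      using word_rep[OF w] by blast
    obtain q where q: "prefix q (concat ws)" "red q = red p"
      using prefix_red p ws by blast
    obtain vs r where vs: "set vs \<subseteq> set ws" "q = concat vs @ r"
      "r = [] \<or> (\<exists>w\<in>set ws. prefix r w)"
      using prefix_concat[OF q(1)] by blast
    have r: "r \<in> Pf"
      using vs(3) ws by (auto simp: Pf_def)
    have qw: "q \<in> words X"
      using q ws concat_words prefix_words by blast
    have "ev p = ev q"
      using q qw prefix_words[OF p w(1)] by (simp add: ev_eq_iff)
    also have "\<dots> = ev (concat vs) \<otimes> ev r"
      using vs qw by (simp add: ev_append)
    finally have "c = (H #> ev (concat vs)) #> ev r"
      using c qw vs H by (simp add: coset_mult_assoc subgroup.subset)
    also have "H #> ev (concat vs) = H"
      using vs ws concat_H[of vs] qw H by (simp add: coset_join2 subset_trans)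
    finally show "c \<in> (\<lambda>r. H #> ev r) ` Pf"
      using r by blast
  qed
  ultimately show "finite (core H)"
    by (blast intro: finite_subset)
  have "letters_of H \<subseteq> (\<Union>w\<in>W. set w)"
  proof
    fix x assume "x \<in> letters_of H"
    then obtain w where w: "w \<in> words X" "reduced w" "ev w \<in> H" and x: "x \<in> set w"
      by (auto simp: letters_of_def)
    obtain ws where ws: "set ws \<subseteq> W" "w = red (concat ws)"
      using word_rep[OF w] by blast
    then have "x \<in> set (concat ws)"
      using x set_red by blast
    then show "x \<in> (\<Union>w\<in>W. set w)"
      using ws by auto
  qed
  then show "finite (letters_of H)"
    using W(1) by (blast intro: finite_subset)
qed

text \<open>Schreier's method: a transversal of the core turns each word representing an element of
  \<open>H\<close> into a product of Schreier generators.\<close>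

lemma core_finite_imp_fin_gen:
  assumes H: "subgroup H G" and fin: "finite (core H)" "finite (letters_of H)"
  shows "fin_gen_subgroup H G"
proof -
  note Hsub = subgroup.subset[OF H]
  \<comment> \<open>The coset \<open>H\<close> itself is represented by \<open>\<one>\<close>, which
    makes both ends of the telescoping product below trivial.\<close>
  define t where "t c = (if c = H then \<one> else SOME g. g \<in> c)" for c :: "'a set"
  have t: "t (H #> g) \<in> carrier G \<and> (\<exists>h\<in>H. t (H #> g) = h \<otimes> g)" if g: "g \<in> carrier G" for g
  proof (cases "H #> g = H")
    case True
    then have "g \<in> H"
      using coset_join1[of H g] g H Hsub by blast
    then have "inv g \<in> H" "inv g \<otimes> g = \<one>"
      using H g by (simp_all add: subgroup.m_inv_closed)
    then show ?thesis
      using True by (auto simp: t_def intro!: bexI[of _ "inv g"])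
  next
    case False
    have "g \<in> H #> g"
      using rcos_self[OF g H] .
    then have "t (H #> g) \<in> H #> g"
      using False by (auto simp: t_def intro: someI)
    then show ?thesis
      using g Hsub by (auto simp: r_coset_def)
  qed
  have t': "g \<otimes> inv (t (H #> g)) \<in> H" if g: "g \<in> carrier G" for g
  proof -
    obtain h where h: "h \<in> H" "t (H #> g) = h \<otimes> g" "h \<in> carrier G"
      using t[OF g] Hsub by blast
    then have "g \<otimes> inv (t (H #> g)) = inv h"
      using g by (simp add: inv_mult_group m_assoc[symmetric])
    then show ?thesis
      using h H by (simp add: subgroup.m_inv_closed)
  qed
  have cancel: "inv a \<otimes> (a \<otimes> z) = z" "a \<otimes> (inv a \<otimes> z) = z"
    if "a \<in> carrier G" "z \<in> carrier G" for a z
    using that by (simp_all add: m_assoc[symmetric])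
  \<comment> \<open>Intersecting with \<open>H\<close> replaces the condition that \<open>x\<close>
    leads from the coset \<open>c\<close> to the coset \<open>d\<close>, and places \<open>B\<close>
    inside \<open>H\<close> at once.\<close>
  define B where "B = (\<lambda>(c, x, d). t c \<otimes> ev [x] \<otimes> inv (t d)) ` (core H \<times> letters_of H \<times> core H) \<inter> H"
  have B: "finite B" "B \<subseteq> carrier G" "B \<subseteq> H"
    using fin Hsub by (auto simp: B_def)
  \<comment> \<open>Telescoping: each letter appended to \<open>p\<close> contributes one Schreier
    generator on the right. For \<open>p = w\<close> the representative is \<open>\<one>\<close>,
    which leaves \<open>ev w\<close>.\<close>
  have gen: "ev p \<otimes> inv (t (H #> ev p)) \<in> generate G B"
    if w: "w \<in> words X" "reduced w" "ev w \<in> H" and p: "prefix p w" for p w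
    using p
  proof (induction p rule: rev_induct)
    case Nil
    have "t (H #> \<one>) = \<one>"
      using Hsub by (simp add: t_def)
    then show ?case
      by (simp add: generate.one)
  next
    case (snoc x p)
    then have p: "prefix p w"
      by (meson append_prefixD)
    have px: "p @ [x] \<in> words X"
      using prefix_words snoc.prems w by blast
    then have c: "ev p \<in> carrier G" "ev [x] \<in> carrier G" "ev (p @ [x]) \<in> carrier G"
      by auto
    define c d where "c = H #> ev p" and "d = H #> ev (p @ [x])"
    have tc: "t c \<in> carrier G" "t d \<in> carrier G"
      using t[OF c(1)] t[OF c(3)] by (simp_all add: c_def d_def)
    have ev: "ev (p @ [x]) = ev p \<otimes> ev [x]"
      using px by (simp add: ev_append)
    have s: "t c \<otimes> ev [x] \<otimes> inv (t d) =
        inv (ev p \<otimes> inv (t c)) \<otimes> (ev (p @ [x]) \<otimes> inv (t d))"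
      using c tc by (simp add: ev inv_mult_group m_assoc cancel)
    have "t c \<otimes> ev [x] \<otimes> inv (t d) \<in> H"
      unfolding s using t'[OF c(1)] t'[OF c(3)] H
      by (simp add: c_def d_def subgroup.m_closed subgroup.m_inv_closed)
    moreover have "c \<in> core H" "d \<in> core H"
      using w p snoc.prems by (auto simp: core_def c_def d_def)
    moreover have "x \<in> letters_of H"
      using w snoc.prems set_mono_prefix by (fastforce simp: letters_of_def)
    ultimately have "t c \<otimes> ev [x] \<otimes> inv (t d) \<in> B"
      by (force simp: B_def)
    then have "(ev p \<otimes> inv (t c)) \<otimes> (t c \<otimes> ev [x] \<otimes> inv (t d)) \<in> generate G B"
      using snoc.IH[OF p] by (auto simp: c_def intro: generate.intros)
    moreover have "(ev p \<otimes> inv (t c)) \<otimes> (t c \<otimes> ev [x] \<otimes> inv (t d)) = ev (p @ [x]) \<otimes> inv (t d)"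
      using c tc by (simp add: ev m_assoc cancel)
    ultimately show ?case
      by (simp add: d_def)
  qed
  have "H = generate G B"
  proof
    show "generate G B \<subseteq> H"
      using generate_subgroup_incl[OF B(3) H] .
    show "H \<subseteq> generate G B"
    proof
      fix h assume h: "h \<in> H"
      then obtain v where v: "v \<in> words X" "ev v = h"
        using ev_surj Hsub by blast
      then have w: "red v \<in> words X" "reduced (red v)" "ev (red v) = h"
        by (simp_all add: words_red ev_red)
      have "t (H #> h) = \<one>"
        using h H Hsub by (simp add: t_def coset_join2 subsetD)
      then show "h \<in> generate G B"
        using gen[OF w(1,2), of "red v"] h w(3) Hsub by (auto simp: subsetD)
    qed
  qed
  then show ?thesis
    using B H by (auto simp: fin_gen_subgroup_def)
qed

theorem howson: "howson_group G"
  unfolding howson_group_def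
proof (intro conjI allI impI is_group)
  fix H K assume HK: "fin_gen_subgroup H G \<and> fin_gen_subgroup K G"
  then have sub: "subgroup H G" "subgroup K G"
    by (auto simp: fin_gen_subgroup_def)
  have inter: "(H \<inter> K) #> g = (H #> g) \<inter> (K #> g)" if "g \<in> carrier G" for g
  proof -
    have "h = k" if "h \<in> H" "k \<in> K" "h \<otimes> g = k \<otimes> g" for h k
      using that \<open>g \<in> carrier G\<close> sub subgroup.mem_carrier right_cancel by metis
    then show ?thesis
      unfolding r_coset_def by blast
  qed
  have "core (H \<inter> K) \<subseteq> (\<lambda>(C, D). C \<inter> D) ` (core H \<times> core K)"
  proof
    fix c assume "c \<in> core (H \<inter> K)"
    then obtain p w where *: "c = (H \<inter> K) #> ev p" "w \<in> words X" "reduced w" "ev w \<in> H \<inter> K"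
      "prefix p w"
      by (auto simp: core_def)
    have "c = (H #> ev p) \<inter> (K #> ev p)"
      using * prefix_words inter by blast
    moreover have "H #> ev p \<in> core H" "K #> ev p \<in> core K"
      using * by (auto simp: core_def)
    ultimately show "c \<in> (\<lambda>(C, D). C \<inter> D) ` (core H \<times> core K)"
      by blast
  qed
  then have "finite (core (H \<inter> K))"
    using fin_gen_imp_core_finite(1) HK by (meson finite_SigmaI finite_imageI finite_subset)
  moreover have "letters_of (H \<inter> K) \<subseteq> letters_of H"
    by (auto simp: letters_of_def)
  then have "finite (letters_of (H \<inter> K))"
    using fin_gen_imp_core_finite(2) HK finite_subset by blast
  ultimately show "fin_gen_subgroup (H \<inter> K) G"
    using core_finite_imp_fin_gen subgroups_Inter_pair[OF sub] by blast
qed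

end

subsection \<open>Free groups and evaluation of words\<close>

lemma equiv_free_group_cong: "equiv (words X) (free_group_cong X)"
proof (rule equivI)
  show "free_group_cong X \<subseteq> words X \<times> words X"
    using free_group_cong_words by fastforce
  show "refl_on (words X) (free_group_cong X)"
    by (auto simp: refl_on_def intro: free_group_cong.refl)
  show "sym (free_group_cong X)"
    by (auto simp: sym_def intro: free_group_cong.sym)
  show "trans (free_group_cong X)"
    by (rule transI) (rule free_group_cong.trans)
qed

lemma FG_mult_class:
  assumes "u \<in> words X" "v \<in> words X"
  shows "free_group_cong X `` {u} \<otimes>\<^bsub>FG X\<^esub> free_group_cong X `` {v} = free_group_cong X `` {u @ v}"
proof -
  have "free_group_cong X `` {u' @ v'} = free_group_cong X `` {u @ v}"
    if "u' \<in> free_group_cong X `` {u}" "v' \<in> free_group_cong X `` {v}" for u' v'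
    using that by (intro equiv_class_eq[OF equiv_free_group_cong])
      (auto intro: free_group_cong.compat free_group_cong.sym)
  moreover have "u \<in> free_group_cong X `` {u}" "v \<in> free_group_cong X `` {v}"
    using equiv_class_self[OF equiv_free_group_cong] assms by auto
  ultimately have "(\<Union>u'\<in>free_group_cong X `` {u}. \<Union>v'\<in>free_group_cong X `` {v}.
      free_group_cong X `` {u' @ v'}) = free_group_cong X `` {u @ v}"
    by blast
  then show ?thesis
    by (simp add: FG_def)
qed

lemma FG_class_closed: "w \<in> words X \<Longrightarrow> free_group_cong X `` {w} \<in> carrier (FG X)"
  by (simp add: FG_def quotientI)

lemma FG_classE:
  assumes "c \<in> carrier (FG X)"
  obtains w where "w \<in> words X" "c = free_group_cong X `` {w}"
  using assms by (auto simp: FG_def elim: quotientE)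

lemma FG_class_eq_iff:
  "u \<in> words X \<Longrightarrow> v \<in> words X \<Longrightarrow>
   free_group_cong X `` {u} = free_group_cong X `` {v} \<longleftrightarrow> red u = red v"
  by (simp add: eq_equiv_class_iff[OF equiv_free_group_cong] free_group_cong_iff)

lemma free_group_on_imp_eval:
  assumes "free_group_on G X"
  obtains ev where "free_group_eval G X ev"
proof -
  from assms obtain \<phi> where G: "group G" and \<phi>: "\<phi> \<in> iso (FG X) G"
    by (auto simp: free_group_on_def)
  then have hom: "\<phi> \<in> hom (FG X) G" and bij: "bij_betw \<phi> (carrier (FG X)) (carrier G)"
    by (auto simp: iso_def)
  define ev where "ev w = \<phi> (free_group_cong X `` {w})" for w
  interpret group G by (rule G)
  have "free_group_eval G X ev"
  proof
    fix w assume w: "w \<in> words X"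
    show "ev w \<in> carrier G"
      unfolding ev_def by (rule hom_in_carrier[OF hom FG_class_closed[OF w]])
  next
    fix g assume "g \<in> carrier G"
    then have "g \<in> \<phi> ` carrier (FG X)"
      unfolding bij_betw_imp_surj_on[OF bij] .
    then obtain c where c: "c \<in> carrier (FG X)" "g = \<phi> c"
      by (rule imageE)
    from c(1) obtain w where "w \<in> words X" "c = free_group_cong X `` {w}"
      by (rule FG_classE)
    then show "\<exists>w\<in>words X. ev w = g"
      unfolding ev_def c(2) by blast
  next
    fix u v assume uv: "u \<in> words X" "v \<in> words X"
    then show "ev (u @ v) = ev u \<otimes>\<^bsub>G\<^esub> ev v"
      unfolding ev_def using hom_mult[OF hom FG_class_closed FG_class_closed, of u v]
      by (simp add: FG_mult_class)
    have "ev u = ev v \<longleftrightarrow> free_group_cong X `` {u} = free_group_cong X `` {v}"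
      using bij uv by (auto simp: ev_def bij_betw_def inj_on_eq_iff FG_class_closed)
    then show "ev u = ev v \<longleftrightarrow> red u = red v"
      using uv by (simp add: FG_class_eq_iff)
  qed
  then show thesis by (rule that)
qed

theorem free_group_imp_howson: "free_group G \<Longrightarrow> howson_group G"
  unfolding free_group_def
  by (metis free_group_on_imp_eval free_group_eval.howson)

text \<open>Converse passage to \<open>free_group_on\<close>, which wants the generators to be
  elements of the group. Accordingly the letters here are group elements, and \<open>ev\<close>
  sends each to itself.\<close>

lemma free_group_evalI:
  assumes ev: "free_group_eval G X ev" and X: "\<And>x. x \<in> X \<Longrightarrow> ev [(x, True)] = x"
  shows "free_group_on G X"
proof -
  interpret free_group_eval G X ev by (rule ev)
  define \<phi> where "\<phi> c = ev (SOME w. w \<in> words X \<and> c = free_group_cong X `` {w})" for c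
  have \<phi>: "\<phi> (free_group_cong X `` {w}) = ev w" if w: "w \<in> words X" for w
  proof -
    define v where "v = (SOME v. v \<in> words X \<and> free_group_cong X `` {w} = free_group_cong X `` {v})"
    have "v \<in> words X \<and> free_group_cong X `` {w} = free_group_cong X `` {v}"
      unfolding v_def using w by (rule_tac someI) blast
    then have "ev v = ev w"
      using w by (metis ev_eq_iff FG_class_eq_iff)
    then show ?thesis
      by (simp only: \<phi>_def v_def)
  qed
  have "\<phi> \<in> iso (FG X) G"
  proof (rule isoI)
    show "\<phi> \<in> hom (FG X) G"
    proof (rule homI)
      fix c d assume "c \<in> carrier (FG X)"
      then obtain u where u: "u \<in> words X" "c = free_group_cong X `` {u}"
        by (rule FG_classE)
      then show "\<phi> c \<in> carrier G" by (simp add: \<phi>)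
      assume "d \<in> carrier (FG X)"
      then obtain v where "v \<in> words X" "d = free_group_cong X `` {v}"
        by (rule FG_classE)
      then show "\<phi> (c \<otimes>\<^bsub>FG X\<^esub> d) = \<phi> c \<otimes>\<^bsub>G\<^esub> \<phi> d"
        using u by (simp add: FG_mult_class \<phi> ev_append)
    qed
    show "bij_betw \<phi> (carrier (FG X)) (carrier G)"
      unfolding bij_betw_def
    proof (intro conjI inj_onI)
      show "c = d" if "c \<in> carrier (FG X)" "d \<in> carrier (FG X)" "\<phi> c = \<phi> d" for c d
        using that by (elim FG_classE) (simp add: \<phi> FG_class_eq_iff ev_eq_iff)
      show "\<phi> ` carrier (FG X) = carrier G"
      proof
        show "\<phi> ` carrier (FG X) \<subseteq> carrier G"
          by (auto elim!: FG_classE simp: \<phi>)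
        show "carrier G \<subseteq> \<phi> ` carrier (FG X)"
          using ev_surj \<phi> FG_class_closed by (metis image_eqI subsetI)
      qed
    qed
  qed
  moreover have "X \<subseteq> carrier G"
    using X ev_closed[of "[(_, True)]"] by force
  ultimately show ?thesis
    using X \<phi> by (auto simp: free_group_on_def is_group intro!: bexI[of _ \<phi>])
qed

section \<open>Renaming the alphabet\<close>

lemma map_rcons:
  assumes "inj_on f (fst ` set (a # w))"
  shows "map (apfst f) (rcons a w) = rcons (apfst f a) (map (apfst f) w)"
proof (cases w)
  case (Cons b v)
  have "apfst f b = linv (apfst f a) \<longleftrightarrow> b = linv a"
    using inj_on_eq_iff[OF assms, of "fst b" "fst a"] Cons by (simp add: linv_def prod_eq_iff)
  then show ?thesis using Cons by simp
qed simp

text \<open>Injectivity is asked only on the letters that occur, because the renaming applied later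
  is an \<open>inv_into\<close>, known to be injective only on the set of generators.\<close>

lemma red_map:
  "inj_on f (fst ` set w) \<Longrightarrow> red (map (apfst f) w) = map (apfst f) (red w)"
proof (induction w)
  case (Cons a w)
  have "inj_on f (fst ` set (a # red w))"
    using set_red[of w] by (intro inj_on_subset[OF Cons.prems]) auto
  moreover have "inj_on f (fst ` set w)"
    by (rule inj_on_subset[OF Cons.prems]) auto
  ultimately show ?case
    using Cons.IH by (simp add: map_rcons)
qed simp

lemma fst_words: "w \<in> words X \<Longrightarrow> fst ` set w \<subseteq> X"
  by (induction w) auto

lemma words_map: "w \<in> words X \<Longrightarrow> f ` X \<subseteq> Y \<Longrightarrow> map (apfst f) w \<in> words Y"
  by (induction w) auto

lemma inj_on_map_words:
  assumes "inj_on f X" "u \<in> words X" "v \<in> words X" "map (apfst f) u = map (apfst f) v"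
  shows "u = v"
proof -
  have "inj_on (apfst f) (set u \<union> set v)"
  proof (rule inj_onI)
    fix a b assume "a \<in> set u \<union> set v" "b \<in> set u \<union> set v" "apfst f a = apfst f b"
    moreover from this have "fst a \<in> X" "fst b \<in> X"
      using fst_words[OF assms(2)] fst_words[OF assms(3)] by blast+
    ultimately show "a = b"
      using inj_onD[OF assms(1), of "fst a" "fst b"] by (simp add: prod_eq_iff)
  qed
  then show ?thesis
    using assms(4) map_inj_on by blast
qed

text \<open>Distinct letters are distinct reduced words, so \<open>\<iota>\<close> embeds the
  alphabet into the group. Renaming words along its inverse \<open>\<kappa>\<close> turns the
  letters into the group elements that they denote.\<close>

lemma (in free_group_eval) free_group: "free_group G"
proof -
  define \<iota> where "\<iota> x = ev [(x, True)]" for x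
  define \<kappa> where "\<kappa> = inv_into X \<iota>"
  define Y where "Y = \<iota> ` X"
  have inj: "inj_on \<iota> X"
    by (rule inj_onI) (simp add: \<iota>_def ev_eq_iff)
  have \<kappa>: "\<kappa> (\<iota> x) = x" if "x \<in> X" for x
    using that inj by (simp add: \<kappa>_def)
  have \<kappa>_inj: "inj_on \<kappa> Y"
    unfolding \<kappa>_def Y_def by (rule inj_on_inv_into) simp
  have \<kappa>_im: "\<kappa> ` Y \<subseteq> X"
    using \<kappa> by (auto simp: Y_def)
  have \<kappa>_words: "map (apfst \<kappa>) w \<in> words X" if "w \<in> words Y" for w
    by (rule words_map[OF that \<kappa>_im])
  define ev' where "ev' w = ev (map (apfst \<kappa>) w)" for w
  have "free_group_eval G Y ev'"
  proof
    show "ev' w \<in> carrier G" if "w \<in> words Y" for w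
      unfolding ev'_def by (rule ev_closed[OF \<kappa>_words[OF that]])
    show "\<exists>w\<in>words Y. ev' w = g" if g: "g \<in> carrier G" for g
    proof -
      obtain w where w: "w \<in> words X" "ev w = g"
        using ev_surj[OF g] by blast
      have "map (apfst \<kappa>) (map (apfst \<iota>) w) = w"
        using w(1) by (induction w) (auto simp: \<kappa>)
      then have "ev' (map (apfst \<iota>) w) = g"
        unfolding ev'_def using w(2) by simp
      moreover have "map (apfst \<iota>) w \<in> words Y"
        by (rule words_map[OF w(1)]) (simp add: Y_def)
      ultimately show ?thesis
        by blast
    qed
    fix u v assume uv: "u \<in> words Y" "v \<in> words Y"
    then have uv': "map (apfst \<kappa>) u \<in> words X" "map (apfst \<kappa>) v \<in> words X"
      by (simp_all add: \<kappa>_words)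
    then show "ev' (u @ v) = ev' u \<otimes> ev' v"
      by (simp add: ev'_def ev_append)
    have "red (map (apfst \<kappa>) w) = map (apfst \<kappa>) (red w)" if "w \<in> words Y" for w
      using inj_on_subset[OF \<kappa>_inj] fst_words[OF that] by (intro red_map) blast
    then show "ev' u = ev' v \<longleftrightarrow> red u = red v"
      using uv uv' inj_on_map_words[OF \<kappa>_inj words_red words_red, OF uv]
      by (auto simp: ev'_def ev_eq_iff)
  qed
  then have "free_group_on G Y"
    by (rule free_group_evalI) (auto simp: Y_def ev'_def \<kappa>, simp add: \<iota>_def)
  then show ?thesis
    by (auto simp: free_group_def)
qed

section \<open>Semidirect products\<close>

locale sl_action = group G for G (structure) +
  fixes E :: "('e, 'm) sgrp_scheme" and \<theta>
  assumes semilattice_action: "semilattice_action G E \<theta>"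
begin

lemma E_closed [simp]: "x \<in> carrier E \<Longrightarrow> y \<in> carrier E \<Longrightarrow> x \<cdot>\<^bsub>E\<^esub> y \<in> carrier E"
  and E_assoc: "x \<in> carrier E \<Longrightarrow> y \<in> carrier E \<Longrightarrow> z \<in> carrier E \<Longrightarrow>
    (x \<cdot>\<^bsub>E\<^esub> y) \<cdot>\<^bsub>E\<^esub> z = x \<cdot>\<^bsub>E\<^esub> (y \<cdot>\<^bsub>E\<^esub> z)"
  and E_comm: "x \<in> carrier E \<Longrightarrow> y \<in> carrier E \<Longrightarrow> x \<cdot>\<^bsub>E\<^esub> y = y \<cdot>\<^bsub>E\<^esub> x"
  and E_idem [simp]: "x \<in> carrier E \<Longrightarrow> x \<cdot>\<^bsub>E\<^esub> x = x"
  and E_nonempty: "carrier E \<noteq> {}"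
  using semilattice_action
  unfolding semilattice_action_def meet_semilattice_def semigroup_on_carrier_def by blast+

lemma E_left_idem [simp]:
  "x \<in> carrier E \<Longrightarrow> y \<in> carrier E \<Longrightarrow> x \<cdot>\<^bsub>E\<^esub> (x \<cdot>\<^bsub>E\<^esub> y) = x \<cdot>\<^bsub>E\<^esub> y"
  by (simp add: E_assoc[symmetric])

lemma hom_Aut: "\<theta> \<in> hom G (semilattice_Aut E)"
  using semilattice_action by (simp add: semilattice_action_def)

lemma \<theta>_Bij: "g \<in> carrier G \<Longrightarrow> \<theta> g \<in> Bij (carrier E)"
  and \<theta>_hom: "g \<in> carrier G \<Longrightarrow> \<theta> g \<in> sgrp_hom E E"
  using hom_in_carrier[OF hom_Aut, of g] by (simp_all add: semilattice_Aut_def)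

lemma \<theta>_closed [simp]: "g \<in> carrier G \<Longrightarrow> x \<in> carrier E \<Longrightarrow> \<theta> g x \<in> carrier E"
  using \<theta>_hom[of g] by (auto simp: sgrp_hom_def)

lemma \<theta>_meet:
  "g \<in> carrier G \<Longrightarrow> x \<in> carrier E \<Longrightarrow> y \<in> carrier E \<Longrightarrow> \<theta> g (x \<cdot>\<^bsub>E\<^esub> y) = \<theta> g x \<cdot>\<^bsub>E\<^esub> \<theta> g y"
  using \<theta>_hom[of g] by (simp add: sgrp_hom_def)

lemma \<theta>_mult:
  "g \<in> carrier G \<Longrightarrow> h \<in> carrier G \<Longrightarrow> x \<in> carrier E \<Longrightarrow> \<theta> (g \<otimes> h) x = \<theta> g (\<theta> h x)"
  using hom_mult[OF hom_Aut, of g h] \<theta>_Bij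
  by (simp add: semilattice_Aut_def BijGroup_def compose_def)

text \<open>\<open>hom\<close> speaks of products only. It makes \<open>\<theta> \<one>\<close> an
  idempotent map, and an injective idempotent map is the identity.\<close>

lemma \<theta>_one [simp]:
  assumes x: "x \<in> carrier E"
  shows "\<theta> \<one> x = x"
proof -
  have "inj_on (\<theta> \<one>) (carrier E)"
    using \<theta>_Bij[OF one_closed] by (simp add: Bij_def bij_betw_def)
  moreover have "\<theta> \<one> (\<theta> \<one> x) = \<theta> \<one> x"
    using \<theta>_mult[of \<one> \<one> x] x by simp
  ultimately show ?thesis
    using x by (simp add: inj_on_eq_iff)
qed

lemma \<theta>_inv_cancel [simp]:
  "g \<in> carrier G \<Longrightarrow> x \<in> carrier E \<Longrightarrow> \<theta> g (\<theta> (inv g) x) = x"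
  "g \<in> carrier G \<Longrightarrow> x \<in> carrier E \<Longrightarrow> \<theta> (inv g) (\<theta> g x) = x"
  by (simp_all add: \<theta>_mult[symmetric])

abbreviation SP where "SP \<equiv> semidirect_product E \<theta> G"

lemma SP_carrier [simp]: "carrier SP = carrier E \<times> carrier G"
  by (simp add: semidirect_product_def)

lemma SP_mult [simp]: "(e, g) \<cdot>\<^bsub>SP\<^esub> (f, h) = (e \<cdot>\<^bsub>E\<^esub> \<theta> g f, g \<otimes> h)"
  by (simp add: semidirect_product_def)

lemma inverse_semigroup_SP: "inverse_semigroup SP"
  unfolding inverse_semigroup_def
proof (intro conjI ballI)
  show "semigroup_on_carrier SP"
    using E_nonempty one_closed
    by (auto simp: semigroup_on_carrier_def \<theta>_meet \<theta>_mult E_assoc m_assoc)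
  fix s assume "s \<in> carrier SP"
  then obtain e g where s: "s = (e, g)" "e \<in> carrier E" "g \<in> carrier G"
    by auto
  show "\<exists>!t. t \<in> carrier SP \<and> sgrp_inverses SP s t"
  proof (rule ex1I[of _ "(\<theta> (inv g) e, inv g)"])
    show "(\<theta> (inv g) e, inv g) \<in> carrier SP \<and> sgrp_inverses SP s (\<theta> (inv g) e, inv g)"
      using s by (simp add: sgrp_inverses_def)
    fix t assume "t \<in> carrier SP \<and> sgrp_inverses SP s t"
    then obtain f h where t: "t = (f, h)" "f \<in> carrier E" "h \<in> carrier G"
      and inv: "sgrp_inverses SP s t" by auto
    have "g \<otimes> h \<otimes> g = g"
      using inv by (simp add: s t sgrp_inverses_def)
    then have "h \<otimes> g = \<one>"
      using s t by (simp add: m_assoc)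
    then have h: "h = inv g"
      using s t by (simp add: inv_equality)
    \<comment> \<open>The two equations say that \<open>e\<close> lies below
      \<open>\<theta> g f\<close> and \<open>f\<close> below \<open>\<theta> (inv g) e\<close>.
      Applying \<open>\<theta> (inv g)\<close> to the first gives the reverse of the second.\<close>
    have "e \<cdot>\<^bsub>E\<^esub> \<theta> g f = e" and 2: "f \<cdot>\<^bsub>E\<^esub> \<theta> (inv g) e = f"
      using inv s t E_comm[of "e \<cdot>\<^bsub>E\<^esub> \<theta> g f" e] E_comm[of "f \<cdot>\<^bsub>E\<^esub> \<theta> (inv g) e" f]
      by (simp_all add: sgrp_inverses_def h E_assoc)
    then have "\<theta> (inv g) (e \<cdot>\<^bsub>E\<^esub> \<theta> g f) = \<theta> (inv g) e"
      by simp
    then have "\<theta> (inv g) e \<cdot>\<^bsub>E\<^esub> f = \<theta> (inv g) e"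
      using s t by (simp add: \<theta>_meet)
    then have "f = \<theta> (inv g) e"
      using 2 s t E_comm[of f "\<theta> (inv g) e"] by simp
    then show "t = (\<theta> (inv g) e, inv g)"
      by (simp add: t h)
  qed
qed

sublocale SP: inv_sgrp SP
  by unfold_locales (rule inverse_semigroup_SP)

lemma SP_inv:
  assumes "e \<in> carrier E" "g \<in> carrier G"
  shows "sgrp_inv SP (e, g) = (\<theta> (inv g) e, inv g)"
  by (rule SP.iv_unique) (use assms in simp_all)

lemma SP_mult_inv:
  assumes "e \<in> carrier E" "g \<in> carrier G"
  shows "(e, g) \<cdot>\<^bsub>SP\<^esub> sgrp_inv SP (e, g) = (e, \<one>)"
  using assms by (simp add: SP_inv)

end

subsection \<open>Embeddings\<close>

locale inv_sgrp_embedding = S: inv_sgrp S + T: inv_sgrp T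
  for S :: "('a, 'm) sgrp_scheme" and T :: "('b, 'n) sgrp_scheme" +
  fixes \<phi> :: "'a \<Rightarrow> 'b"
  assumes embedding: "sgrp_embedding S T \<phi>"
begin

lemma \<phi>_closed [simp]: "x \<in> carrier S \<Longrightarrow> \<phi> x \<in> carrier T"
  and \<phi>_mult: "x \<in> carrier S \<Longrightarrow> y \<in> carrier S \<Longrightarrow> \<phi> (x \<cdot>\<^bsub>S\<^esub> y) = \<phi> x \<cdot>\<^bsub>T\<^esub> \<phi> y"
  and \<phi>_inj: "inj_on \<phi> (carrier S)"
  using embedding by (auto simp: sgrp_embedding_def sgrp_hom_def)

lemma \<phi>_iv:
  assumes "x \<in> carrier S"
  shows "\<phi> (sgrp_inv S x) = sgrp_inv T (\<phi> x)"
  by (rule T.iv_unique[symmetric])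
    (use assms S.mult_iv_mult S.iv_mult_iv in \<open>simp_all add: \<phi>_mult[symmetric] S.assoc\<close>)

end

context inv_sgrp
begin

lemma inv_generate_closed: "x \<in> inv_generate S A \<Longrightarrow> A \<subseteq> carrier S \<Longrightarrow> x \<in> carrier S"
  by (induction rule: inv_generate.induct) auto

lemma inverse_subsemigroup_inv_generate:
  "A \<subseteq> carrier S \<Longrightarrow> inverse_subsemigroup (inv_generate S A) S"
  using inv_generate_closed
  by (auto simp: inverse_subsemigroup_def intro: inv_generate.prod inv_generate.inv)

lemma fin_gen_inv_generate:
  "finite A \<Longrightarrow> A \<subseteq> carrier S \<Longrightarrow> fin_gen_inverse_subsemigroup (inv_generate S A) S"
  using inverse_subsemigroup_inv_generate by (auto simp: fin_gen_inverse_subsemigroup_def)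

end

context inv_sgrp_embedding
begin

lemma image_inv_generate:
  assumes A: "A \<subseteq> carrier S"
  shows "\<phi> ` inv_generate S A = inv_generate T (\<phi> ` A)"
proof (intro equalityI subsetI)
  fix y assume "y \<in> \<phi> ` inv_generate S A"
  then obtain x where x: "x \<in> inv_generate S A" "y = \<phi> x" by blast
  from x(1) have "\<phi> x \<in> inv_generate T (\<phi> ` A)"
    by (induction rule: inv_generate.induct)
      (use S.inv_generate_closed[OF _ A] in \<open>auto simp: \<phi>_mult \<phi>_iv intro: inv_generate.intros\<close>)
  then show "y \<in> inv_generate T (\<phi> ` A)" using x by simp
next
  fix y assume "y \<in> inv_generate T (\<phi> ` A)"
  then show "y \<in> \<phi> ` inv_generate S A"
  proof (induction rule: inv_generate.induct)
    case (incl a)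
    then show ?case by (auto intro: inv_generate.incl)
  next
    case (inv y)
    then obtain x where x: "x \<in> inv_generate S A" "y = \<phi> x" by blast
    then have "sgrp_inv T y = \<phi> (sgrp_inv S x)"
      using S.inv_generate_closed[OF _ A] by (simp add: \<phi>_iv)
    then show ?case
      using x by (auto intro: inv_generate.inv)
  next
    case (prod y y')
    then obtain x x' where x: "x \<in> inv_generate S A" "y = \<phi> x"
      "x' \<in> inv_generate S A" "y' = \<phi> x'" by blast
    then have "y \<cdot>\<^bsub>T\<^esub> y' = \<phi> (x \<cdot>\<^bsub>S\<^esub> x')"
      using S.inv_generate_closed[OF _ A] by (simp add: \<phi>_mult)
    then show ?case
      using x by (auto intro: inv_generate.prod)
  qed
qed

lemma fin_gen_image:
  assumes "fin_gen_inverse_subsemigroup H S"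
  shows "fin_gen_inverse_subsemigroup (\<phi> ` H) T"
proof -
  obtain A where A: "finite A" "A \<subseteq> carrier S" "H = inv_generate S A"
    using assms by (auto simp: fin_gen_inverse_subsemigroup_def)
  then have "\<phi> ` A \<subseteq> carrier T"
    by auto
  then show ?thesis
    using A T.fin_gen_inv_generate[of "\<phi> ` A"] by (simp add: image_inv_generate)
qed

text \<open>An injective map commutes with intersections, and images of finitely generated
  subsemigroups are finitely generated. Generators of the intersection of the images lie in the
  image, so finitely many preimages generate the original intersection.\<close>

theorem howson_reflect:
  assumes "howson_inverse_semigroup T"
  shows "howson_inverse_semigroup S"
  unfolding howson_inverse_semigroup_def
proof (intro allI impI)
  fix H K
  assume HK: "fin_gen_inverse_subsemigroup H S \<and> fin_gen_inverse_subsemigroup K S"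
  then have sub: "inverse_subsemigroup H S" "inverse_subsemigroup K S"
    by (auto simp: fin_gen_inverse_subsemigroup_def)
  then have HKc: "H \<subseteq> carrier S" "K \<subseteq> carrier S"
    by (auto simp: inverse_subsemigroup_def)
  have "fin_gen_inverse_subsemigroup (\<phi> ` H \<inter> \<phi> ` K) T"
    using assms HK fin_gen_image by (simp add: howson_inverse_semigroup_def)
  also have "\<phi> ` H \<inter> \<phi> ` K = \<phi> ` (H \<inter> K)"
    using inj_on_image_Int[OF \<phi>_inj HKc] by simp
  finally obtain B where B: "finite B" "\<phi> ` (H \<inter> K) = inv_generate T B"
    by (auto simp: fin_gen_inverse_subsemigroup_def)
  have "B \<subseteq> \<phi> ` (H \<inter> K)"
    unfolding B(2) by (auto intro: inv_generate.incl)
  then obtain A where A: "A \<subseteq> H \<inter> K" "finite A" "B = \<phi> ` A"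
    using B(1) by (meson finite_subset_image)
  have Ac: "A \<subseteq> carrier S"
    using A HKc by blast
  have "\<phi> ` (H \<inter> K) = \<phi> ` inv_generate S A"
    unfolding B(2) A(3) by (rule image_inv_generate[OF Ac, symmetric])
  moreover have "H \<inter> K \<subseteq> carrier S" "inv_generate S A \<subseteq> carrier S"
    using HKc S.inv_generate_closed[OF _ Ac] by auto
  ultimately have "H \<inter> K = inv_generate S A"
    using inj_on_image_eq_iff[OF \<phi>_inj] by metis
  then show "fin_gen_inverse_subsemigroup (H \<inter> K) S"
    using S.fin_gen_inv_generate[OF A(2) Ac] by simp
qed

end

subsection \<open>Locally finite actions\<close>

text \<open>The exponent is shifted, as a semigroup has no zeroth powers: \<open>spow S a n\<close> is
  the power \<open>a\<^bsup>n+1\<^esup>\<close>.\<close>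

primrec spow :: "('a, 'm) sgrp_scheme \<Rightarrow> 'a \<Rightarrow> nat \<Rightarrow> 'a" where
  "spow S a 0 = a"
| "spow S a (Suc n) = spow S a n \<cdot>\<^bsub>S\<^esub> a"

lemma (in inv_sgrp) spow_closed [simp]: "a \<in> carrier S \<Longrightarrow> spow S a n \<in> carrier S"
  by (induction n) auto

lemma (in inv_sgrp_embedding) \<phi>_spow: "a \<in> carrier S \<Longrightarrow> \<phi> (spow S a n) = spow T (\<phi> a) n"
  by (induction n) (auto simp: \<phi>_mult)

text \<open>If the orbit of \<open>e\<close> under the powers of \<open>g\<close> is finite then some power \<open>g\<^bsup>k\<^esup>\<close> with \<open>k > 0\<close>
  fixes \<open>e\<close>, and the descending sequence of the meets of \<open>e, g\<cdot>e, \<dots>, g\<^bsup>n\<^esup>\<cdot>e\<close> has a repetition.\<close>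

lemma (in sl_action) locally_finite_spow:
  assumes fin: "locally_finite_action G E \<theta>" and s: "s \<in> carrier SP"
  shows "\<exists>n. spow SP s n \<cdot>\<^bsub>SP\<^esub> sgrp_inv SP (spow SP s n) =
    spow SP s (Suc n) \<cdot>\<^bsub>SP\<^esub> sgrp_inv SP (spow SP s (Suc n))"
proof -
  obtain e g where eg: "s = (e, g)" "e \<in> carrier E" "g \<in> carrier G"
    using s by auto
  have "fin_gen_subgroup (generate G {g}) G"
    using eg(3) generate_is_subgroup[of "{g}"] by (auto simp: fin_gen_subgroup_def)
  then have orbit: "finite {\<theta> h e | h. h \<in> generate G {g}}"
    using fin eg(2) by (auto simp: locally_finite_action_def)
  have pow: "g [^] (n::nat) \<in> generate G {g}" for n
    by (induction n) (auto intro: generate.intros)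
  then have "range (\<lambda>n::nat. \<theta> (g [^] n) e) \<subseteq> {\<theta> h e | h. h \<in> generate G {g}}"
    by blast
  then have "finite (range (\<lambda>n::nat. \<theta> (g [^] n) e))"
    using orbit by (rule finite_subset)
  then have "\<not> inj (\<lambda>n::nat. \<theta> (g [^] n) e)"
    using finite_imageD[of "\<lambda>n::nat. \<theta> (g [^] n) e" UNIV] infinite_UNIV_nat by blast
  then have "\<exists>i j :: nat. i < j \<and> \<theta> (g [^] i) e = \<theta> (g [^] j) e"
    by (rule contrapos_np) (auto intro: linorder_injI)
  then obtain i j :: nat where ij: "i < j" "\<theta> (g [^] i) e = \<theta> (g [^] j) e"
    by blast
  \<comment> \<open>With the shift in \<open>spow\<close>, index \<open>n\<close> belongs to the
    exponent \<open>Suc n\<close>, which is the period \<open>j - i\<close>.\<close>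
  define n where "n = j - Suc i"
  have j: "j = i + Suc n"
    using ij by (simp add: n_def)
  have "\<theta> (g [^] i) (\<theta> (g [^] Suc n) e) = \<theta> (g [^] i) e"
    using ij(2) eg \<theta>_mult[of "g [^] i" "g [^] Suc n" e] nat_pow_mult[of g i "Suc n"]
    by (simp only: j nat_pow_closed)
  then have fix_e: "\<theta> (g [^] Suc n) e = e"
    using eg \<theta>_inv_cancel(2)[of "g [^] i" e] \<theta>_inv_cancel(2)[of "g [^] i" "\<theta> (g [^] Suc n) e"]
    by simp
  \<comment> \<open>\<open>m\<close> is the meet of the first translates of \<open>e\<close>, but
    only that it lies below \<open>e\<close> is recorded: the next translate to be met is
    \<open>\<theta> (g [^] Suc n) e\<close>, which equals \<open>e\<close> by
    \<open>fix_e\<close>.\<close>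
  have "\<exists>m. m \<in> carrier E \<and> spow SP s k = (m, g [^] Suc k) \<and> m \<cdot>\<^bsub>E\<^esub> e = m" for k
  proof (induction k)
    case 0
    then show ?case using eg by simp
  next
    case (Suc k)
    then obtain m where m: "m \<in> carrier E" "spow SP s k = (m, g [^] Suc k)" "m \<cdot>\<^bsub>E\<^esub> e = m"
      by blast
    define f where "f = \<theta> (g [^] Suc k) e"
    have f: "f \<in> carrier E"
      using eg by (simp add: f_def)
    have "(m \<cdot>\<^bsub>E\<^esub> f) \<cdot>\<^bsub>E\<^esub> e = m \<cdot>\<^bsub>E\<^esub> f"
      using m f eg E_comm[of f e] by (metis E_assoc)
    then show ?case
      using m f eg by (simp add: f_def)
  qed
  then obtain m where m: "m \<in> carrier E" "spow SP s n = (m, g [^] Suc n)" "m \<cdot>\<^bsub>E\<^esub> e = m"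
    by blast
  then have "spow SP s (Suc n) = (m, g [^] Suc (Suc n))"
    using eg fix_e by simp
  then show ?thesis
    using m eg by (intro exI[of _ n]) (simp add: SP_mult_inv del: spow.simps nat_pow_Suc)
qed

section \<open>Free inverse semigroups\<close>

lemma vagner_cong_words:
  "(u, v) \<in> vagner_cong X \<Longrightarrow> u \<in> words X \<and> u \<noteq> [] \<and> v \<in> words X \<and> v \<noteq> []"
  by (induction rule: vagner_cong.induct) auto

lemma equiv_vagner_cong: "equiv (words X - {[]}) (vagner_cong X)"
proof (rule equivI)
  show "vagner_cong X \<subseteq> (words X - {[]}) \<times> (words X - {[]})"
    using vagner_cong_words by fastforce
  show "refl_on (words X - {[]}) (vagner_cong X)"
    by (auto simp: refl_on_def intro: vagner_cong.refl)
  show "sym (vagner_cong X)"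
    by (auto simp: sym_def intro: vagner_cong.sym)
  show "trans (vagner_cong X)"
    by (rule transI) (rule vagner_cong.trans)
qed

lemma FIS_mult_class:
  assumes "u \<in> words X - {[]}" "v \<in> words X - {[]}"
  shows "vagner_cong X `` {u} \<cdot>\<^bsub>FIS X\<^esub> vagner_cong X `` {v} = vagner_cong X `` {u @ v}"
proof -
  have "vagner_cong X `` {u' @ v'} = vagner_cong X `` {u @ v}"
    if "u' \<in> vagner_cong X `` {u}" "v' \<in> vagner_cong X `` {v}" for u' v'
    using that by (intro equiv_class_eq[OF equiv_vagner_cong])
      (auto intro: vagner_cong.compat vagner_cong.sym)
  moreover have "u \<in> vagner_cong X `` {u}" "v \<in> vagner_cong X `` {v}"
    using equiv_class_self[OF equiv_vagner_cong] assms by auto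
  ultimately have "(\<Union>u'\<in>vagner_cong X `` {u}. \<Union>v'\<in>vagner_cong X `` {v}.
      vagner_cong X `` {u' @ v'}) = vagner_cong X `` {u @ v}"
    by blast
  then show ?thesis
    by (simp add: FIS_def)
qed

lemma vagner_cong_red: "(u, v) \<in> vagner_cong X \<Longrightarrow> red u = red v"
proof (induction rule: vagner_cong.induct)
  case (compat u u' v v')
  then show ?case by (intro red_append_cong)
next
  case (regular u)
  then show ?case
    using red_append_cong[of "u @ word_inv u" "[]" u u] by simp
next
  case (commute u v)
  then show ?case
    using red_append_cong[of "u @ word_inv u" "[]" "v @ word_inv v" "[]"]
      red_append_cong[of "v @ word_inv v" "[]" "u @ word_inv u" "[]"] by simp
qed auto

lemma red_double_eq:
  assumes "red (w @ w) = red w"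
  shows "red w = []"
proof -
  have "red w = red ((word_inv w @ w) @ w)"
    using red_append_cong[of "word_inv w @ w" "[]" w w] by simp
  also have "\<dots> = red (word_inv w @ w)"
    using red_append_cong[of "word_inv w" "word_inv w" "w @ w" w] assms by simp
  finally show ?thesis by simp
qed

text \<open>Hides the quotient construction behind evaluation of words. Words are nonempty
  throughout, as the empty word denotes no element of the semigroup.\<close>

locale free_inv_sgrp_eval = inv_sgrp F for F (structure) +
  fixes X :: "'x set" and cl :: "'x word \<Rightarrow> 'a"
  assumes cl_closed [simp, intro]: "w \<in> words X \<Longrightarrow> w \<noteq> [] \<Longrightarrow> cl w \<in> carrier F"
    and cl_surj: "s \<in> carrier F \<Longrightarrow> \<exists>w\<in>words X. w \<noteq> [] \<and> cl w = s"
    and cl_append: "u \<in> words X \<Longrightarrow> u \<noteq> [] \<Longrightarrow> v \<in> words X \<Longrightarrow> v \<noteq> [] \<Longrightarrow>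
      cl (u @ v) = cl u \<cdot> cl v"
    and cl_eq_iff: "u \<in> words X \<Longrightarrow> u \<noteq> [] \<Longrightarrow> v \<in> words X \<Longrightarrow> v \<noteq> [] \<Longrightarrow>
      cl u = cl v \<longleftrightarrow> (u, v) \<in> vagner_cong X"

lemma free_inverse_semigroup_on_eval:
  assumes "free_inverse_semigroup_on F X"
  obtains cl where "free_inv_sgrp_eval F X cl"
proof -
  from assms obtain \<phi> where F: "inverse_semigroup F" and \<phi>: "\<phi> \<in> sgrp_iso (FIS X) F"
    by (auto simp: free_inverse_semigroup_on_def)
  then have bij: "bij_betw \<phi> (carrier (FIS X)) (carrier F)"
    and into: "\<And>c. c \<in> carrier (FIS X) \<Longrightarrow> \<phi> c \<in> carrier F"
    and mult: "\<And>c d. c \<in> carrier (FIS X) \<Longrightarrow> d \<in> carrier (FIS X) \<Longrightarrow>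
      \<phi> (c \<cdot>\<^bsub>FIS X\<^esub> d) = \<phi> c \<cdot>\<^bsub>F\<^esub> \<phi> d"
    by (auto simp: sgrp_iso_def sgrp_hom_def)
  have cc: "vagner_cong X `` {w} \<in> carrier (FIS X)" if "w \<in> words X" "w \<noteq> []" for w
    using that by (simp add: FIS_def quotientI)
  define cl where "cl w = \<phi> (vagner_cong X `` {w})" for w
  have "free_inv_sgrp_eval F X cl"
  proof
    show "inverse_semigroup F" by (rule F)
    show "cl w \<in> carrier F" if "w \<in> words X" "w \<noteq> []" for w
      unfolding cl_def by (rule into[OF cc[OF that]])
    show "\<exists>w\<in>words X. w \<noteq> [] \<and> cl w = s" if s: "s \<in> carrier F" for s
    proof -
      have "s \<in> \<phi> ` carrier (FIS X)"
        using s unfolding bij_betw_imp_surj_on[OF bij] .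
      then obtain w where "w \<in> words X" "w \<noteq> []" "s = \<phi> (vagner_cong X `` {w})"
        by (auto simp: FIS_def elim!: quotientE)
      then show ?thesis
        unfolding cl_def by blast
    qed
    fix u v assume uv: "u \<in> words X" "u \<noteq> []" "v \<in> words X" "v \<noteq> []"
    show "cl (u @ v) = cl u \<cdot>\<^bsub>F\<^esub> cl v"
      using mult[OF cc[OF uv(1,2)] cc[OF uv(3,4)]] uv by (simp add: cl_def FIS_mult_class)
    have "cl u = cl v \<longleftrightarrow> vagner_cong X `` {u} = vagner_cong X `` {v}"
      unfolding cl_def
      by (rule inj_on_eq_iff[OF bij_betw_imp_inj_on[OF bij] cc[OF uv(1,2)] cc[OF uv(3,4)]])
    also have "\<dots> \<longleftrightarrow> (u, v) \<in> vagner_cong X"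
      using uv by (intro eq_equiv_class_iff[OF equiv_vagner_cong]) auto
    finally show "cl u = cl v \<longleftrightarrow> (u, v) \<in> vagner_cong X" .
  qed
  then show thesis by (rule that)
qed

context free_inv_sgrp_eval
begin

lemma cl_word_inv:
  assumes w: "w \<in> words X" "w \<noteq> []"
  shows "iv (cl w) = cl (word_inv w)"
proof (rule iv_unique)
  have 1: "cl (u @ word_inv u @ u) = cl u" if "u \<in> words X" "u \<noteq> []" for u
    using that vagner_cong.regular[of u X] by (simp add: cl_eq_iff)
  show "cl w \<cdot> cl (word_inv w) \<cdot> cl w = cl w"
    using 1[of w] w by (simp add: cl_append assoc)
  show "cl (word_inv w) \<cdot> cl w \<cdot> cl (word_inv w) = cl (word_inv w)"
    using 1[of "word_inv w"] w by (simp add: cl_append assoc)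
qed (use w in auto)

lemma cl_eq_imp_red_eq:
  "u \<in> words X \<Longrightarrow> u \<noteq> [] \<Longrightarrow> v \<in> words X \<Longrightarrow> v \<noteq> [] \<Longrightarrow> cl u = cl v \<Longrightarrow> red u = red v"
  using cl_eq_iff vagner_cong_red by blast

lemma idem_cl_imp_red:
  assumes "w \<in> words X" "w \<noteq> []" "cl w \<in> idems F"
  shows "red w = []"
proof (rule red_double_eq, rule cl_eq_imp_red_eq)
  show "cl (w @ w) = cl w"
    using assms by (simp add: cl_append idemsD)
qed (use assms in auto)

text \<open>A nonempty word that reduces to the empty word is a product of words \<open>a u a\<^sup>-\<^sup>1\<close> where
  \<open>u\<close> again reduces to the empty word.\<close>

lemma red_Nil_imp_idem:
  "w \<in> words X \<Longrightarrow> w \<noteq> [] \<Longrightarrow> red w = [] \<Longrightarrow> cl w \<in> idems F"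
proof (induction w rule: length_induct)
  case (1 w)
  obtain a w' where w: "w = a # w'"
    using 1(3) by (cases w) auto
  \<comment> \<open>Prepending \<open>a\<close> can yield the empty word only by cancelling the sole
    letter of \<open>red w'\<close>.\<close>
  have "red w' = [linv a]"
    using 1(4) w by (cases "red w'") (auto split: if_splits)
  then obtain u v where uv: "w' = u @ linv a # v" "red u = []" "red v = []"
    by (rule red_eq_ConsE)
  have wX: "[a] \<in> words X" "[linv a] \<in> words X" "u \<in> words X" "v \<in> words X"
    using 1(2) w uv by auto
  have a': "cl [linv a] = iv (cl [a])"
    using cl_word_inv[of "[a]"] wX by simp
  have left: "cl (a # u @ [linv a]) \<in> idems F"
  proof (cases "u = []")
    case True
    then show ?thesis
      using cl_append[of "[a]" "[linv a]"] wX a' by simp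
  next
    case False
    have "cl u \<in> idems F"
      using 1(1) False wX uv w by auto
    moreover have "cl (a # u @ [linv a]) = cl [a] \<cdot> (cl u \<cdot> iv (cl [a]))"
      using cl_append[of "[a]" "u @ [linv a]"] cl_append[of u "[linv a]"] wX a' False by simp
    ultimately show ?thesis
      using conj_idem[of "cl u" "cl [a]"] wX by simp
  qed
  show ?case
  proof (cases "v = []")
    case True
    then show ?thesis
      using left w uv by simp
  next
    case False
    have "cl v \<in> idems F"
      using 1(1) False wX uv w by auto
    then show ?thesis
      using idem_mult[OF left] cl_append[of "a # u @ [linv a]" v] wX False w uv by simp
  qed
qed

text \<open>\<open>red\<close> respects concatenation and is empty exactly on the words of
  idempotents; if it is empty on \<open>u\<close> and on \<open>u @ v\<close>, then also on
  \<open>v\<close>.\<close>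

lemma e_unitary: "e_unitary F"
  unfolding e_unitary_def
proof (intro ballI impI)
  fix e s assume e: "e \<in> idems F" and s: "s \<in> carrier F" and le: "nat_le F e s"
  then obtain f where f: "f \<in> idems F" "e = f \<cdot> s"
    by (auto simp: nat_le_def)
  obtain u where u: "u \<in> words X" "u \<noteq> []" "cl u = f"
    using cl_surj[OF idems_closed[OF f(1)]] by blast
  obtain v where v: "v \<in> words X" "v \<noteq> []" "cl v = s"
    using cl_surj[OF s] by blast
  have "cl (u @ v) = e"
    using u v f by (simp add: cl_append)
  then have "red (u @ v) = []"
    using u v e by (intro idem_cl_imp_red) simp_all
  moreover have "red u = []"
    using u f by (intro idem_cl_imp_red) simp_all
  ultimately have "red v = []"
    using red_append_cong[of u "[]" v v] by simp
  then show "s \<in> idems F"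
    using red_Nil_imp_idem v by blast
qed

lemma sig_cl_one_iff:
  assumes "w \<in> words X" "w \<noteq> []"
  shows "sig (cl w) = \<one>\<^bsub>GI\<^esub> \<longleftrightarrow> red w = []"
  using assms e_unitary_sig_one[OF e_unitary, of "cl w"] idem_cl_imp_red[of w]
    red_Nil_imp_idem[of w] sig_idem[of "cl w"] cl_closed[of w] by metis

text \<open>The empty word has no value under \<open>cl\<close>, so the identity is assigned to it
  by hand.\<close>

definition ev :: "'x word \<Rightarrow> 'a set" where
  "ev w = (if w = [] then \<one>\<^bsub>GI\<^esub> else sig (cl w))"

lemma ev_closed: "w \<in> words X \<Longrightarrow> ev w \<in> carrier GI"
  by (simp add: ev_def one_GI_closed)

lemma ev_append: "u \<in> words X \<Longrightarrow> v \<in> words X \<Longrightarrow> ev (u @ v) = ev u \<otimes>\<^bsub>GI\<^esub> ev v"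
  by (simp add: ev_def cl_append sig_mult)

lemma ev_one_iff: "w \<in> words X \<Longrightarrow> ev w = \<one>\<^bsub>GI\<^esub> \<longleftrightarrow> red w = []"
  using sig_cl_one_iff[of w] by (cases "w = []") (simp_all add: ev_def)

lemma free_group_eval_GI: "free_group_eval GI X ev"
proof
  show "\<exists>w\<in>words X. ev w = g" if "g \<in> carrier GI" for g
    using that
  proof (rule GI_elemE)
    fix s assume s: "s \<in> carrier F" "g = sig s"
    obtain w where "w \<in> words X" "w \<noteq> []" "cl w = s"
      using cl_surj[OF s(1)] by blast
    then show ?thesis
      using s(2) by (intro bexI[of _ w]) (simp_all add: ev_def)
  qed
  fix u v assume uv: "u \<in> words X" "v \<in> words X"
  have inv: "ev (word_inv u) \<otimes>\<^bsub>GI\<^esub> ev u = \<one>\<^bsub>GI\<^esub>"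
    using uv by (simp add: ev_append[symmetric] ev_one_iff)
  then have "ev (word_inv u) = inv\<^bsub>GI\<^esub> (ev u)"
    using uv by (simp add: ev_closed G.inv_equality)
  \<comment> \<open>Equality is reduced to triviality of a quotient, which \<open>ev_one_iff\<close>
    decides.\<close>
  then have "ev u = ev v \<longleftrightarrow> ev (word_inv u @ v) = \<one>\<^bsub>GI\<^esub>"
    using uv ev_closed[OF uv(1)] ev_closed[OF uv(2)]
    by (metis ev_append words_word_inv G.inv_closed G.inv_equality G.inv_inv G.l_inv)
  also have "\<dots> \<longleftrightarrow> red (word_inv u @ v) = []"
    using uv by (simp add: ev_one_iff)
  also have "\<dots> \<longleftrightarrow> red u = red v"
  proof
    assume "red u = red v"
    then show "red (word_inv u @ v) = []"
      using red_append_cong[of "word_inv u" "word_inv u" v u] by simp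
  next
    assume "red (word_inv u @ v) = []"
    then show "red u = red v"
      using red_append_cong[of u u "word_inv u @ v" "[]"]
        red_append_cong[of "u @ word_inv u" "[]" v v] by simp
  qed
  finally show "ev u = ev v \<longleftrightarrow> red u = red v" .
qed (simp_all add: ev_closed ev_append)

lemma free_group_GI: "free_group GI"
  using free_group_eval.free_group[OF free_group_eval_GI] .

end

subsection \<open>Representations by partial injections\<close>

definition letter_rel :: "('x \<Rightarrow> ('q \<times> 'q) set) \<Rightarrow> 'x \<times> bool \<Rightarrow> ('q \<times> 'q) set" where
  "letter_rel r a = (if snd a then r (fst a) else (r (fst a))\<inverse>)"

text \<open>Words are read from left to right in the automaton with transition relations
  \<open>r\<close>, so concatenation becomes \<open>O\<close> without reversal.\<close>

primrec word_rel :: "('x \<Rightarrow> ('q \<times> 'q) set) \<Rightarrow> 'x word \<Rightarrow> ('q \<times> 'q) set" where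
  "word_rel r [] = Id"
| "word_rel r (a # w) = letter_rel r a O word_rel r w"

lemma word_rel_append: "word_rel r (u @ v) = word_rel r u O word_rel r v"
  by (induction u) auto

lemma word_rel_word_inv: "word_rel r (word_inv w) = (word_rel r w)\<inverse>"
  by (induction w) (auto simp: word_rel_append converse_relcomp letter_rel_def linv_def)

definition partial_inj :: "('q \<times> 'q) set \<Rightarrow> bool" where
  "partial_inj R \<longleftrightarrow> single_valued R \<and> single_valued (R\<inverse>)"

lemma partial_inj_word_rel:
  assumes "\<And>x. partial_inj (r x)"
  shows "partial_inj (word_rel r w)"
  using assms
  by (induction w)
    (auto simp: partial_inj_def letter_rel_def converse_relcomp intro!: single_valued_relcomp)

text \<open>Both Vagner relations hold for partial injections:
  \<open>R O R\<inverse> O R = R\<close>, and the relations \<open>R O R\<inverse>\<close> are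
  partial identities, which commute since their composition is intersection.\<close>

lemma word_rel_vagner:
  assumes r: "\<And>x. partial_inj (r x)"
  shows "(u, v) \<in> vagner_cong X \<Longrightarrow> word_rel r u = word_rel r v"
proof (induction rule: vagner_cong.induct)
  case (regular u)
  have "R O R\<inverse> O R = R" if "partial_inj R" for R :: "('b \<times> 'b) set"
    using that by (auto simp: partial_inj_def single_valued_def)
  then show ?case
    using partial_inj_word_rel[of r u, OF r] by (simp add: word_rel_append word_rel_word_inv)
next
  case (commute u v)
  have *: "A O B = A \<inter> B" if "A \<subseteq> Id" "B \<subseteq> Id" for A B :: "('b \<times> 'b) set"
    using that by auto
  have "R O R\<inverse> \<subseteq> Id" if "partial_inj R" for R :: "('b \<times> 'b) set"
    using that by (auto simp: partial_inj_def single_valued_def)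
  then have "word_rel r w O (word_rel r w)\<inverse> \<subseteq> Id" for w
    using partial_inj_word_rel[of r w, OF r] by blast
  then show ?case
    using *[of "word_rel r u O (word_rel r u)\<inverse>" "word_rel r v O (word_rel r v)\<inverse>"]
      *[of "word_rel r v O (word_rel r v)\<inverse>" "word_rel r u O (word_rel r u)\<inverse>"]
    by (simp add: word_rel_append word_rel_word_inv O_assoc[symmetric] Int_commute)
qed (auto simp: word_rel_append)

context free_inv_sgrp_eval
begin

text \<open>For partial injections the choice of the representing word is immaterial by
  \<open>word_rel_vagner\<close>.\<close>

definition elem_rel :: "('x \<Rightarrow> ('q \<times> 'q) set) \<Rightarrow> 'a \<Rightarrow> ('q \<times> 'q) set" where
  "elem_rel r s = word_rel r (SOME w. w \<in> words X \<and> w \<noteq> [] \<and> cl w = s)"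

lemma elem_rel_cl:
  assumes r: "\<And>x. partial_inj (r x)" and w: "w \<in> words X" "w \<noteq> []"
  shows "elem_rel r (cl w) = word_rel r w"
proof -
  define v where "v = (SOME v. v \<in> words X \<and> v \<noteq> [] \<and> cl v = cl w)"
  have v: "v \<in> words X \<and> v \<noteq> [] \<and> cl v = cl w"
    unfolding v_def by (rule someI[of _ w]) (use w in simp)
  then have "(v, w) \<in> vagner_cong X"
    using w cl_eq_iff[of v w] by simp
  then have "word_rel r v = word_rel r w"
    by (rule word_rel_vagner[OF r])
  then show ?thesis
    by (simp only: elem_rel_def v_def)
qed

lemma elem_rel_mult:
  assumes r: "\<And>x. partial_inj (r x)" and "s \<in> carrier F" "t \<in> carrier F"
  shows "elem_rel r (s \<cdot> t) = elem_rel r s O elem_rel r t"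
proof -
  obtain u v where u: "u \<in> words X" "u \<noteq> []" "s = cl u" and v: "v \<in> words X" "v \<noteq> []" "t = cl v"
    using cl_surj assms(2,3) by blast
  then show ?thesis
    using elem_rel_cl[OF r, of "u @ v"] elem_rel_cl[OF r, of u] elem_rel_cl[OF r, of v]
    by (simp add: cl_append word_rel_append)
qed

lemma elem_rel_iv:
  assumes r: "\<And>x. partial_inj (r x)" and "s \<in> carrier F"
  shows "elem_rel r (iv s) = (elem_rel r s)\<inverse>"
proof -
  obtain u where u: "u \<in> words X" "u \<noteq> []" "s = cl u"
    using cl_surj assms(2) by blast
  then show ?thesis
    using elem_rel_cl[OF r, of "word_inv u"] elem_rel_cl[OF r, of u]
    by (simp add: cl_word_inv word_rel_word_inv)
qed

end

section \<open>Failure of the Howson property\<close>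

text \<open>An inverse automaton shaped like a ladder: \<open>x\<close> moves along the rail of states \<open>(0, i)\<close>, as
  long as \<open>i \<in> D\<close>, and \<open>y\<close> leads from \<open>(0, i)\<close> to the tip \<open>(1, i)\<close>. The additional state
  \<open>(2, 0)\<close> marks the position \<open>0\<close>, since only there \<open>y\<^sup>-\<^sup>1\<close> can be read on the rail.\<close>

definition ladder :: "'x \<Rightarrow> 'x \<Rightarrow> nat set \<Rightarrow> 'x \<Rightarrow> ((nat \<times> nat) \<times> (nat \<times> nat)) set" where
  "ladder x y D z =
    (if z = x then {((0, i), (0, Suc i)) | i. i \<in> D}
     else if z = y then insert ((2, 0), (0, 0)) {((0, i), (1, i)) | i. True}
     else {})"

lemma ladder_rail: "ladder x y D x = {((0, i), (0, Suc i)) | i. i \<in> D}"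
  by (simp add: ladder_def)

lemma ladder_tips:
  "x \<noteq> y \<Longrightarrow> ladder x y D y = insert ((2, 0), (0, 0)) {((0, i), (1, i)) | i. True}"
  by (simp add: ladder_def)

lemma partial_inj_ladder: "partial_inj (ladder x y D z)"
  by (auto simp: partial_inj_def ladder_def single_valued_def)

lemma letter_ladder_mono: "D \<subseteq> D' \<Longrightarrow> letter_rel (ladder x y D) a \<subseteq> letter_rel (ladder x y D') a"
  by (auto simp: letter_rel_def ladder_def split: if_splits)

lemma word_ladder_mono: "D \<subseteq> D' \<Longrightarrow> word_rel (ladder x y D) w \<subseteq> word_rel (ladder x y D') w"
proof (induction w)
  case (Cons a w)
  then show ?case
    using relcomp_mono[OF letter_ladder_mono[OF Cons.prems, of x y a]] by simp
qed simp

lemma letter_ladder_bounded: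
  assumes "(p, q) \<in> letter_rel (ladder x y UNIV) a"
  shows "\<exists>N. (p, q) \<in> letter_rel (ladder x y {..<N}) a"
  using assms
  \<comment> \<open>A rail edge needs the index of its lower end in the set; which of the two states
    that is depends on the sign of the letter, hence the maximum.\<close>
  by (intro exI[of _ "Suc (max (snd p) (snd q))"])
    (auto simp: letter_rel_def ladder_def split: if_splits)

lemma word_ladder_bounded:
  "(p, q) \<in> word_rel (ladder x y UNIV) w \<Longrightarrow> \<exists>N. (p, q) \<in> word_rel (ladder x y {..<N}) w"
proof (induction w arbitrary: p)
  case (Cons a w)
  then obtain p' where p': "(p, p') \<in> letter_rel (ladder x y UNIV) a"
    "(p', q) \<in> word_rel (ladder x y UNIV) w"
    by auto
  obtain N M where "(p, p') \<in> letter_rel (ladder x y {..<N}) a"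
    "(p', q) \<in> word_rel (ladder x y {..<M}) w"
    using letter_ladder_bounded[OF p'(1)] Cons.IH[OF p'(2)] by blast
  then have "(p, p') \<in> letter_rel (ladder x y {..<max N M}) a"
    "(p', q) \<in> word_rel (ladder x y {..<max N M}) w"
    using letter_ladder_mono[of "{..<N}" "{..<max N M}" x y a]
      word_ladder_mono[of "{..<M}" "{..<max N M}" x y w] by auto
  then show ?case by auto
qed auto

context free_inv_sgrp_eval
begin

abbreviation gen :: "'x \<Rightarrow> 'a" where "gen x \<equiv> cl [(x, True)]"

lemma elem_rel_gen: "x \<in> X \<Longrightarrow> elem_rel (ladder x' y' D) (gen x) = ladder x' y' D x"
  by (subst elem_rel_cl) (simp_all add: partial_inj_ladder letter_rel_def)

abbreviation ladder_rel where "ladder_rel x y D \<equiv> elem_rel (ladder x y D)"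

lemmas ladder_rel_mult = elem_rel_mult[of "ladder _ _ _", OF partial_inj_ladder]
  and ladder_rel_iv = elem_rel_iv[of "ladder _ _ _", OF partial_inj_ladder]

lemma gen_closed [simp]: "x \<in> X \<Longrightarrow> gen x \<in> carrier F"
  by simp

lemma ladder_rel_mono:
  assumes "s \<in> carrier F" "D \<subseteq> D'"
  shows "ladder_rel x y D s \<subseteq> ladder_rel x y D' s"
proof -
  obtain w where "w \<in> words X" "w \<noteq> []" "cl w = s"
    using cl_surj[OF assms(1)] by blast
  then show ?thesis
    using word_ladder_mono[OF assms(2)] elem_rel_cl[of "ladder x y _" w, OF partial_inj_ladder]
    by metis
qed

lemma ladder_rel_bounded:
  assumes "s \<in> carrier F" "(p, q) \<in> ladder_rel x y UNIV s"
  shows "\<exists>N. (p, q) \<in> ladder_rel x y {..<N} s"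
proof -
  obtain w where "w \<in> words X" "w \<noteq> []" "cl w = s"
    using cl_surj[OF assms(1)] by blast
  then show ?thesis
    using word_ladder_bounded[of p q x y w] assms(2)
      elem_rel_cl[of "ladder x y _" w, OF partial_inj_ladder]
    by metis
qed

lemma Domain_ladder_rel_range_idem:
  assumes "s \<in> carrier F"
  shows "Domain (ladder_rel x y D (s \<cdot> iv s)) = Domain (ladder_rel x y D s)"
  using assms by (auto simp: ladder_rel_mult ladder_rel_iv)

text \<open>A range idempotent has the domain of its element. On the rail with the
  \<open>n + 1\<close> edges of \<open>{..n}\<close> the power with \<open>n + 1\<close> factors is
  defined at the origin, the next power is not.\<close>

lemma spow_range_idem_neq:
  assumes x: "x \<in> X"
  shows "spow F (gen x) n \<cdot> iv (spow F (gen x) n) \<noteq>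
    spow F (gen x) (Suc n) \<cdot> iv (spow F (gen x) (Suc n))"
proof -
  \<comment> \<open>\<open>ladder x x D\<close> is the bare rail, because the case
    \<open>z = x\<close> comes first. Index \<open>k\<close> means \<open>k + 1\<close> factors, so
    edges \<open>0\<close> to \<open>k\<close> are used.\<close>
  have rel: "((0, 0), q) \<in> ladder_rel x x D (spow F (gen x) k) \<longleftrightarrow> q = (0, Suc k) \<and> {..k} \<subseteq> D"
    for D k q
  proof (induction k arbitrary: q)
    case 0
    then show ?case
      using x by (auto simp: elem_rel_gen ladder_rail)
  next
    case (Suc k)
    have "((0, 0), q) \<in> ladder_rel x x D (spow F (gen x) (Suc k)) \<longleftrightarrow>
        (\<exists>p. (p = (0, Suc k) \<and> {..k} \<subseteq> D) \<and> (p, q) \<in> ladder x x D x)"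
      using x Suc.IH by (auto simp: ladder_rel_mult elem_rel_gen)
    then show ?case
      by (auto simp: ladder_rail atMost_Suc)
  qed
  have "(0, 0) \<in> Domain (ladder_rel x x {..n} (spow F (gen x) n))"
    by (auto simp: rel Domain_iff)
  moreover have "(0, 0) \<notin> Domain (ladder_rel x x {..n} (spow F (gen x) (Suc n)))"
    by (auto simp: rel Domain_iff simp del: spow.simps)
  ultimately show ?thesis
    using x by (metis Domain_ladder_rel_range_idem spow_closed gen_closed)
qed

text \<open>Both \<open>H = \<langle>x, yy\<^sup>-\<^sup>1, y\<^sup>-\<^sup>1y\<rangle>\<close> and \<open>K = \<langle>y\<^sup>-\<^sup>1yy, y\<^sup>-\<^sup>1xy\<rangle>\<close> contain the idempotents
  \<open>e\<^sub>n = q\<^sub>n q\<^sub>n\<^sup>-\<^sup>1\<close> with \<open>q\<^sub>n = (y\<^sup>-\<^sup>1yy) (y\<^sup>-\<^sup>1xy)\<^sup>n\<close>. On the ladder, elements of \<open>H\<close> map the rail to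
  the rail, while elements of \<open>K\<close> preserve the union of \<open>{(0, 0)}\<close> and the set of tips. An element of
  \<open>H \<inter> K\<close> which is defined at \<open>(0, 0)\<close> therefore fixes it, so a product of such elements cannot
  reach further along the ladder than one of its factors. But \<open>e\<^sub>n\<close> reaches up to \<open>n\<close>.\<close>

theorem not_howson:
  assumes x: "x \<in> X" and y: "y \<in> X" and xy: "x \<noteq> y"
  shows "\<not> howson_inverse_semigroup F"
proof
  assume howson: "howson_inverse_semigroup F"
  define a b where "a = gen x" and "b = gen y"
  have ab: "a \<in> carrier F" "b \<in> carrier F"
    using x y by (simp_all add: a_def b_def)
  have ra: "ladder_rel x y D a = {((0, i), (0, Suc i)) | i. i \<in> D}" for D
    using x by (simp add: a_def elem_rel_gen ladder_rail)
  have rb: "ladder_rel x y D b = insert ((2, 0), (0, 0)) {((0, i), (1, i)) | i. True}" for D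
    using y xy by (simp add: b_def elem_rel_gen ladder_tips)
  define k1 k2 where "k1 = iv b \<cdot> b \<cdot> b" and "k2 = iv b \<cdot> a \<cdot> b"
  define h2 h3 where "h2 = b \<cdot> iv b" and "h3 = iv b \<cdot> b"
  note defs = k1_def k2_def h2_def h3_def
  have c: "k1 \<in> carrier F" "k2 \<in> carrier F" "h2 \<in> carrier F" "h3 \<in> carrier F"
    using ab by (simp_all add: defs)
  \<comment> \<open>From the origin \<open>iv b\<close> leads to \<open>(2, 0)\<close>, then
    \<open>b\<close> leads back and on to the tip \<open>(1, 0)\<close>. From a tip the first two
    letters return to it, and there \<open>b\<close> cannot be read.\<close>
  have rk1: "ladder_rel x y D k1 = {((0, 0), (1, 0))}" for D
    using ab by (auto simp: defs ladder_rel_mult ladder_rel_iv rb)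
  \<comment> \<open>From a tip this descends to the rail, makes one step and climbs to the next tip.
    At the origin \<open>iv b\<close> leads to \<open>(2, 0)\<close>, where \<open>a\<close> cannot
    be read.\<close>
  have rk2: "ladder_rel x y D k2 = {((1, i), (1, Suc i)) | i. i \<in> D}" for D
    using ab by (auto simp: defs ladder_rel_mult ladder_rel_iv ra rb)
  have rh: "ladder_rel x y D h2 \<subseteq> Id" "ladder_rel x y D h3 \<subseteq> Id" for D
    using ab by (auto simp: defs ladder_rel_mult ladder_rel_iv rb)
  define H where "H = inv_generate F {a, h2, h3}"
  define K where "K = inv_generate F {k1, k2}"
  have fg: "fin_gen_inverse_subsemigroup H F" "fin_gen_inverse_subsemigroup K F"
    unfolding H_def K_def using ab c by (auto intro!: fin_gen_inv_generate)
  then have HK: "H \<subseteq> carrier F" "K \<subseteq> carrier F"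
    by (auto simp: fin_gen_inverse_subsemigroup_def inverse_subsemigroup_def)
  have H_rel: "fst p = 0 \<longleftrightarrow> fst q = 0" if "s \<in> H" "(p, q) \<in> ladder_rel x y UNIV s" for s p q
    using that unfolding H_def
  proof (induction arbitrary: p q rule: inv_generate.induct)
    case (incl s)
    then show ?case
      using rh by (auto simp: ra)
  next
    case (inv s)
    moreover have "s \<in> carrier F"
      using inv.hyps HK by (auto simp: H_def)
    ultimately show ?case
      by (auto simp: ladder_rel_iv)
  next
    case (prod s t)
    moreover have "s \<in> carrier F" "t \<in> carrier F"
      using prod.hyps HK by (auto simp: H_def)
    ultimately show ?case
      by (auto simp: ladder_rel_mult)
  qed
  have K_rel: "(p = (0, 0) \<or> fst p = 1) \<longleftrightarrow> (q = (0, 0) \<or> fst q = 1)"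
    if "s \<in> K" "(p, q) \<in> ladder_rel x y UNIV s" for s p q
    using that unfolding K_def
  proof (induction arbitrary: p q rule: inv_generate.induct)
    case (incl s)
    then show ?case
      by (auto simp: rk1 rk2)
  next
    case (inv s)
    moreover have "s \<in> carrier F"
      using inv.hyps HK by (auto simp: K_def)
    ultimately have "(q, p) \<in> ladder_rel x y UNIV s"
      by (simp add: ladder_rel_iv)
    then show ?case
      using inv.IH by blast
  next
    case (prod s t)
    moreover have "s \<in> carrier F" "t \<in> carrier F"
      using prod.hyps HK by (auto simp: K_def)
    ultimately obtain r where "(p, r) \<in> ladder_rel x y UNIV s" "(r, q) \<in> ladder_rel x y UNIV t"
      by (auto simp: ladder_rel_mult)
    then show ?case
      using prod.IH by blast
  qed
  have fix0: "q = (0, 0)" if "s \<in> H \<inter> K" "((0, 0), q) \<in> ladder_rel x y UNIV s" for s q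
    using H_rel[of s "(0, 0)" q] K_rel[of s "(0, 0)" q] that by auto
  define q where "q n = rec_nat k1 (\<lambda>_ s. s \<cdot> k2) n" for n
  have q: "q 0 = k1" "q (Suc n) = q n \<cdot> k2" for n
    by (simp_all add: q_def)
  have qc: "q n \<in> carrier F" for n
    by (induction n) (auto simp: q c)
  have q_K: "q n \<in> K" for n
    by (induction n) (auto simp: q K_def intro: inv_generate.intros)
  have q_rel: "((0, 0), p) \<in> ladder_rel x y D (q n) \<longleftrightarrow> p = (1, n) \<and> {..<n} \<subseteq> D" for D n p
  proof (induction n arbitrary: p)
    case 0
    then show ?case by (auto simp: q rk1)
  next
    case (Suc n)
    have "((0, 0), p) \<in> ladder_rel x y D (q (Suc n)) \<longleftrightarrow>
        (\<exists>r. (r = (1, n) \<and> {..<n} \<subseteq> D) \<and> (r, p) \<in> ladder_rel x y D k2)"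
      using Suc.IH qc c by (auto simp: q ladder_rel_mult)
    then show ?case
      by (auto simp: rk2 lessThan_Suc)
  qed
  \<comment> \<open>\<open>q n\<close> itself leads from the rail to a tip and so is not in
    \<open>H\<close>. Removing its last \<open>b\<close> gives an element \<open>p\<close> of
    \<open>H\<close> with the same range idempotent; the equation
    \<open>p \<cdot> (b \<cdot> iv b) = p\<close> ensures this and absorbs the inner
    \<open>b \<cdot> iv b\<close> in the induction.\<close>
  have "\<exists>p. p \<in> H \<and> q n = p \<cdot> b \<and> p \<cdot> (b \<cdot> iv b) = p" for n
  proof (induction n)
    case 0
    have "h3 \<cdot> h2 \<in> H"
      unfolding H_def by (auto intro: inv_generate.intros)
    then show ?case
      using ab by (intro exI[of _ "h3 \<cdot> h2"]) (simp add: q defs assoc iv_simps)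
  next
    case (Suc n)
    then obtain p where p: "p \<in> H" "q n = p \<cdot> b" "p \<cdot> (b \<cdot> iv b) = p"
      by blast
    have pc: "p \<in> carrier F"
      using p HK by blast
    have "p \<cdot> a \<cdot> h2 \<in> H"
      using p(1) unfolding H_def by (auto intro: inv_generate.intros)
    moreover have "q (Suc n) = (p \<cdot> (b \<cdot> iv b)) \<cdot> (a \<cdot> b)"
      using ab pc by (simp add: q p(2) k2_def assoc)
    then have "q (Suc n) = p \<cdot> a \<cdot> h2 \<cdot> b"
      using ab pc by (simp add: p(3) h2_def assoc iv_simps)
    moreover have "p \<cdot> a \<cdot> h2 \<cdot> (b \<cdot> iv b) = p \<cdot> a \<cdot> h2"
      using ab pc by (simp add: h2_def assoc iv_simps)
    ultimately show ?case
      by blast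
  qed
  then have e_H: "q n \<cdot> iv (q n) \<in> H" for n
  proof -
    obtain p where p: "p \<in> H" "q n = p \<cdot> b" "p \<cdot> (b \<cdot> iv b) = p"
      using \<open>\<And>n. \<exists>p. p \<in> H \<and> q n = p \<cdot> b \<and> p \<cdot> (b \<cdot> iv b) = p\<close> by blast
    have pc: "p \<in> carrier F"
      using p HK by blast
    have "q n \<cdot> iv (q n) = (p \<cdot> (b \<cdot> iv b)) \<cdot> iv p"
      using ab pc by (simp add: p(2) iv_mult assoc)
    then have "q n \<cdot> iv (q n) = p \<cdot> iv p"
      by (simp add: p(3))
    then show ?thesis
      using p(1) by (simp add: H_def inv_generate.intros)
  qed
  have e_K: "q n \<cdot> iv (q n) \<in> K" for n
    using q_K by (simp add: K_def inv_generate.intros)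
  have e_dom: "(0, 0) \<in> Domain (ladder_rel x y D (q n \<cdot> iv (q n))) \<longleftrightarrow> {..<n} \<subseteq> D" for D n
    using qc by (auto simp: Domain_ladder_rel_range_idem Domain_iff q_rel)
  have "fin_gen_inverse_subsemigroup (H \<inter> K) F"
    using howson fg by (simp add: howson_inverse_semigroup_def)
  then obtain A where A: "finite A" "A \<subseteq> carrier F" "H \<inter> K = inv_generate F A"
    by (auto simp: fin_gen_inverse_subsemigroup_def)
  \<comment> \<open>Only the generators defined at the origin need a bound; the implication lets the
    others take any value.\<close>
  have "\<exists>N. (0, 0) \<in> Domain (ladder_rel x y UNIV s) \<longrightarrow>
      (0, 0) \<in> Domain (ladder_rel x y {..<N} s)" if "s \<in> A" for s
    using that A(2) ladder_rel_bounded[of s "(0, 0)"] by (meson Domain_iff subsetD)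
  then obtain N where N: "\<And>s. s \<in> A \<Longrightarrow> (0, 0) \<in> Domain (ladder_rel x y UNIV s) \<Longrightarrow>
      (0, 0) \<in> Domain (ladder_rel x y {..<N s} s)"
    by metis
  \<comment> \<open>The inserted \<open>0\<close> keeps the maximum meaningful when \<open>A\<close>
    is empty.\<close>
  define M where "M = Max (insert 0 (N ` A))"
  have M: "(0, 0) \<in> Domain (ladder_rel x y {..<M} s)"
    if s: "s \<in> A" "(0, 0) \<in> Domain (ladder_rel x y UNIV s)" for s
  proof -
    have "N s \<le> M"
      using s A(1) by (simp add: M_def)
    then have "ladder_rel x y {..<N s} s \<subseteq> ladder_rel x y {..<M} s"
      using s(1) A(2) by (intro ladder_rel_mono) auto
    then show ?thesis
      using N[OF s] by blast
  qed
  have loop: "((0, 0), (0, 0)) \<in> ladder_rel x y {..<M} s"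
    if s: "s \<in> inv_generate F A" "(0, 0) \<in> Domain (ladder_rel x y {..<M} s)" for s
  proof -
    obtain p where p: "((0, 0), p) \<in> ladder_rel x y {..<M} s"
      using s(2) by blast
    then have "((0, 0), p) \<in> ladder_rel x y UNIV s"
      using s(1) inv_generate_closed A(2) ladder_rel_mono[of s "{..<M}" UNIV] by blast
    then show ?thesis
      using fix0 p s(1) A(3) by blast
  qed
  \<comment> \<open>The bound of the generators persists because the origin is fixed: the second
    factor of a product starts at the origin again, and an inverse is defined there only together
    with its element.\<close>
  have dom: "(0, 0) \<in> Domain (ladder_rel x y {..<M} s)"
    if "s \<in> inv_generate F A" "(0, 0) \<in> Domain (ladder_rel x y UNIV s)" for s
    using that
  proof (induction rule: inv_generate.induct)
    case (incl s)
    then show ?case by (rule M)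
  next
    case (inv s)
    have s: "s \<in> carrier F"
      using inv.hyps A(2) inv_generate_closed by blast
    obtain p where p: "((0, 0), p) \<in> ladder_rel x y UNIV (iv s)"
      using inv.prems by blast
    moreover have "iv s \<in> H \<inter> K"
      unfolding A(3) using inv.hyps by (rule inv_generate.inv)
    ultimately have "p = (0, 0)"
      using fix0 by blast
    then have "(0, 0) \<in> Domain (ladder_rel x y UNIV s)"
      using p s by (auto simp: ladder_rel_iv)
    then have "((0, 0), (0, 0)) \<in> ladder_rel x y {..<M} s"
      using inv loop by blast
    then show ?case
      using s by (auto simp: ladder_rel_iv)
  next
    case (prod s t)
    have st: "s \<in> carrier F" "t \<in> carrier F"
      using prod.hyps A(2) inv_generate_closed by blast+
    obtain p r where p: "((0, 0), p) \<in> ladder_rel x y UNIV s" "(p, r) \<in> ladder_rel x y UNIV t"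
      using prod.prems st by (auto simp: ladder_rel_mult)
    have "p = (0, 0)"
      using fix0[of s p] p(1) prod.hyps A(3) by blast
    then have "((0, 0), (0, 0)) \<in> ladder_rel x y {..<M} s"
      "((0, 0), (0, 0)) \<in> ladder_rel x y {..<M} t"
      using p prod loop by blast+
    then show ?case
      using st by (auto simp: ladder_rel_mult)
  qed
  \<comment> \<open>By \<open>e_dom\<close> this idempotent needs \<open>M + 1\<close> rail edges,
    while by \<open>dom\<close> the first \<open>M\<close> suffice.\<close>
  have "q (Suc M) \<cdot> iv (q (Suc M)) \<in> inv_generate F A"
    unfolding A(3)[symmetric] using e_H e_K by (rule IntI)
  moreover have "(0, 0) \<in> Domain (ladder_rel x y UNIV (q (Suc M) \<cdot> iv (q (Suc M))))"
    unfolding e_dom by simp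
  ultimately have "{..<Suc M} \<subseteq> {..<M}"
    unfolding e_dom[symmetric] by (rule dom)
  then show False by auto
qed

end

section \<open>Consequences for semidirect products\<close>

lemma sl_actionI: "semilattice_action G E \<theta> \<Longrightarrow> sl_action G E \<theta>"
  by (simp add: sl_action_def sl_action_axioms_def semilattice_action_def)

lemma inverse_semigroup_semidirect_product:
  "semilattice_action G E \<theta> \<Longrightarrow> inverse_semigroup (semidirect_product E \<theta> G)"
  by (rule sl_action.inverse_semigroup_SP[OF sl_actionI])

lemma howson_semidirect_product_reflect:
  assumes "inverse_semigroup F" "semilattice_action G E \<theta>"
    and "sgrp_embedding F (semidirect_product E \<theta> G) \<phi>"
    and "howson_inverse_semigroup (semidirect_product E \<theta> G)"
  shows "howson_inverse_semigroup F"
proof -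
  interpret inv_sgrp_embedding F "semidirect_product E \<theta> G" \<phi>
    by unfold_locales (use assms inverse_semigroup_semidirect_product in auto)
  show ?thesis
    by (rule howson_reflect[OF assms(4)])
qed

text \<open>The embedding preserves powers and inverses, so the repetition of range idempotents that
  local finiteness forces in the semidirect product would already occur among the powers of a free
  generator, against \<open>spow_range_idem_neq\<close>.\<close>

theorem not_locally_finite:
  assumes F: "free_inv_sgrp_eval F X cl" and x: "x \<in> X"
    and act: "semilattice_action G E \<theta>" and emb: "sgrp_embedding F (semidirect_product E \<theta> G) \<phi>"
  shows "\<not> locally_finite_action G E \<theta>"
proof
  assume fin: "locally_finite_action G E \<theta>"
  interpret F: free_inv_sgrp_eval F X cl by (rule F)
  interpret sl_action G E \<theta>
    by (rule sl_actionI[OF act])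
  interpret inv_sgrp_embedding F SP \<phi>
    by unfold_locales (rule emb)
  let ?s = "F.gen x"
  have s: "?s \<in> carrier F" using x by simp
  obtain n where n: "spow SP (\<phi> ?s) n \<cdot>\<^bsub>SP\<^esub> sgrp_inv SP (spow SP (\<phi> ?s) n) =
      spow SP (\<phi> ?s) (Suc n) \<cdot>\<^bsub>SP\<^esub> sgrp_inv SP (spow SP (\<phi> ?s) (Suc n))"
    using locally_finite_spow[OF fin \<phi>_closed[OF s]] by blast
  define a b where "a = spow F ?s n" and "b = spow F ?s (Suc n)"
  have ab: "a \<in> carrier F" "b \<in> carrier F"
    using s unfolding a_def b_def by (blast intro: F.spow_closed)+
  have "\<phi> (a \<cdot>\<^bsub>F\<^esub> F.iv a) = \<phi> (b \<cdot>\<^bsub>F\<^esub> F.iv b)"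
    using n[folded \<phi>_spow[OF s]] ab by (simp only: \<phi>_mult \<phi>_iv F.iv_closed a_def b_def)
  then have "a \<cdot>\<^bsub>F\<^esub> F.iv a = b \<cdot>\<^bsub>F\<^esub> F.iv b"
    using ab by (intro inj_onD[OF \<phi>_inj]) auto
  then show False
    using F.spow_range_idem_neq[OF x, of n] by (simp only: a_def b_def)
qed

lemma free_inverse_semigroup_on_nonempty:
  assumes "free_inverse_semigroup_on F X"
  shows "X \<noteq> {}"
proof
  assume X: "X = {}"
  obtain cl where "free_inv_sgrp_eval F X cl"
    using assms by (rule free_inverse_semigroup_on_eval)
  then interpret free_inv_sgrp_eval F X cl .
  obtain w where "w \<in> words X" "w \<noteq> []"
    using carrier_nonempty cl_surj by blast
  then show False
    using X by (cases w) auto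
qed

theorem mainTheorem4:
  fixes F :: "'a sgrp"
    and E' :: "'e sgrp" and G' :: "'g monoid" and \<theta>' :: "'g \<Rightarrow> 'e \<Rightarrow> 'e"
  assumes "free_inverse_semigroup F"
  shows
   "(meet_semilattice (ocarroll_semilattice F) \<and>
     free_group (ocarroll_group F) \<and>
     semilattice_action (ocarroll_group F) (ocarroll_semilattice F) (ocarroll_action F) \<and>
     inverse_semigroup (ocarroll_product F) \<and>
     sgrp_embedding F (ocarroll_product F) (ocarroll_map F)) \<and>
    (\<not> monogenic_free_inverse_semigroup F \<longrightarrow>
       \<not> howson_inverse_semigroup F \<and>
       \<not> howson_inverse_semigroup (ocarroll_product F)) \<and>
    howson_group (ocarroll_group F) \<and>
    (\<not> monogenic_free_inverse_semigroup F \<longrightarrow>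
       \<not> locally_finite_action (ocarroll_group F) (ocarroll_semilattice F) (ocarroll_action F)) \<and>
    \<comment> \<open>The consequences hold for every semilattice, free group and action with such an embedding,
      hence for every variant of O'Carroll's construction:\<close>
    (meet_semilattice E' \<and> free_group G' \<and> semilattice_action G' E' \<theta>' \<and>
     (\<exists>\<phi>. sgrp_embedding F (semidirect_product E' \<theta>' G') \<phi>) \<longrightarrow>
       howson_group G' \<and>
       (\<not> monogenic_free_inverse_semigroup F \<longrightarrow>
          \<not> howson_inverse_semigroup (semidirect_product E' \<theta>' G') \<and>
          \<not> locally_finite_action G' E' \<theta>'))"
proof -
  obtain X where X: "free_inverse_semigroup_on F X"
    using assms by (auto simp: free_inverse_semigroup_def)
  obtain cl where cl: "free_inv_sgrp_eval F X cl"
    using X by (rule free_inverse_semigroup_on_eval)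
  interpret F: free_inv_sgrp_eval F X cl by (rule cl)
  obtain x where x: "x \<in> X"
    using free_inverse_semigroup_on_nonempty[OF X] by blast
  have nh: "\<not> howson_inverse_semigroup F" if "\<not> monogenic_free_inverse_semigroup F"
  proof -
    have "X \<noteq> {x}"
      using that X by (auto simp: monogenic_free_inverse_semigroup_def)
    then obtain y where "y \<in> X" "x \<noteq> y"
      using x by blast
    then show ?thesis
      using F.not_howson x by blast
  qed
  note act = F.semilattice_action_ocarroll
  note emb = F.ocarroll_embedding[OF F.e_unitary]
  note emb' = emb[unfolded ocarroll_product_def]
  note oc = inverse_semigroup_semidirect_product[OF act, folded ocarroll_product_def]
    not_locally_finite[OF cl x act emb']
    howson_semidirect_product_reflect[OF F.inverse_semigroup act emb', folded ocarroll_product_def]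
  show ?thesis
    using F.meet_semilattice_OS F.free_group_GI act oc emb nh
      free_group_imp_howson[OF F.free_group_GI] free_group_imp_howson[of G']
      not_locally_finite[OF cl x, of G' E' \<theta>']
      howson_semidirect_product_reflect[OF F.inverse_semigroup, of G' E' \<theta>']
    by blast
qed

end
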